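(* Let $\Omega\subset\mathbb{R}^d$ be a closed $\eta$-prox-regular set. Assume either (i) $\Omega$ is bounded and $W,V\in C^1(\mathbb{R}^d)$ are respectively $\lambda_W$-geodesically convex on $\mathrm{Conv}(\Omega-\Omega)$ and $\lambda_V$-geodesically convex on $\mathrm{Conv}(\Omega)$; or (ii) $\Omega$ is unbounded and $W,V\in C^1(\mathbb{R}^d)$ satisfy $|\nabla W(x)|\le C(1+|x|)$ and $|\nabla V(x)|\le C(1+|x|)$ for all $x$. Then for any $n\in\mathbb{N}$, any $(x_1,\dots,x_n)\in\Omega^n$ and any $(m_1,\dots,m_n)$ with $m_i\ge0$, $\sum_im_i=1$, the system $$\dot x_i(t)=P_{x_i(t)}\Big(-\sum_{j=1}^nm_j\nabla W(x_i(t)-x_j(t))-\nabla V(x_i(t))\Big),\qquad x_i(0)=x_i\in\Omega,\qquad i=1,\dots,n,$$ has a locally absolutely continuous solution (the equations holding for a.e. $t\ge0$).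
   Context: For closed $S$, $P_S(y)$ is the set of nearest points; proximal normal cone $N^P(S,x)=\{v:\exists\alpha>0,\ x\in P_S(x+\alpha v)\}$; $S$ is $\eta$-prox-regular if for all $x\in\partial S$, $v\in N^P(S,x)$, $|v|=1$, the open ball $B_\eta(x+\eta v)$ misses $S$. $T(\Omega,x)$ is the Clarke tangent cone ($v$ such that for all $t_n\searrow0$, $x_n\in\Omega$, $x_n\to x$, there exist $v_n\to v$ with $x_n+t_nv_n\in\Omega$), and $P_x(w)$ is the nearest point of $T(\Omega,x)$ to $w$. $f$ is $\lambda$-geodesically convex on convex $K$ if $f(y)\ge f(x)+\langle\nabla f(x),y-x\rangle+\frac\lambda2|y-x|^2$ on $K$; $\mathrm{Conv}$ is convex hull and $\Omega-\Omega=\{x-y:x,y\in\Omega\}$. *)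

theory Defs
  imports "HOL-Analysis.Analysis"
begin

definition nearest_points :: "'a::euclidean_space set \<Rightarrow> 'a \<Rightarrow> 'a set" where
  "nearest_points S y = {z \<in> S. \<forall>w\<in>S. dist y z \<le> dist y w}"

definition proximal_normal_cone :: "'a::euclidean_space set \<Rightarrow> 'a \<Rightarrow> 'a set" where
  "proximal_normal_cone S x = {v. \<exists>\<alpha>>0. x \<in> nearest_points S (x + \<alpha> *\<^sub>R v)}"

definition prox_regular :: "real \<Rightarrow> 'a::euclidean_space set \<Rightarrow> bool" where
  "prox_regular \<eta> S \<longleftrightarrow>
     (\<forall>x\<in>frontier S. \<forall>v\<in>proximal_normal_cone S x. norm v = 1 \<longrightarrow>
        ball (x + \<eta> *\<^sub>R v) \<eta> \<inter> S = {})"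

definition clarke_tangent_cone :: "'a::euclidean_space set \<Rightarrow> 'a \<Rightarrow> 'a set" where
  "clarke_tangent_cone \<Omega> x = {v. \<forall>(t::nat \<Rightarrow> real) (xs::nat \<Rightarrow> 'a).
      (\<forall>k. t k > 0) \<and> t \<longlonglongrightarrow> 0 \<and> (\<forall>k. xs k \<in> \<Omega>) \<and> xs \<longlonglongrightarrow> x \<longrightarrow>
      (\<exists>vs::nat \<Rightarrow> 'a. vs \<longlonglongrightarrow> v \<and> (\<forall>k. xs k + t k *\<^sub>R vs k \<in> \<Omega>))}"

definition tangent_proj :: "'a::euclidean_space set \<Rightarrow> 'a \<Rightarrow> 'a \<Rightarrow> 'a" where
  "tangent_proj \<Omega> x w = closest_point (clarke_tangent_cone \<Omega> x) w"

definition geodesically_convex_on :: "real \<Rightarrow> 'a::euclidean_space set \<Rightarrow> ('a \<Rightarrow> real) \<Rightarrow> ('a \<Rightarrow> 'a) \<Rightarrow> bool" where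
  "geodesically_convex_on lam K f gf \<longleftrightarrow>
     (\<forall>x\<in>K. \<forall>y\<in>K. f y \<ge> f x + inner (gf x) (y - x) + lam / 2 * (norm (y - x))\<^sup>2)"

definition set_diff_minus :: "'a::euclidean_space set \<Rightarrow> 'a set" where
  "set_diff_minus \<Omega> = {x - y | x y. x \<in> \<Omega> \<and> y \<in> \<Omega>}"

definition C1_with_gradient :: "('a::euclidean_space \<Rightarrow> real) \<Rightarrow> ('a \<Rightarrow> 'a) \<Rightarrow> bool" where
  "C1_with_gradient f g \<longleftrightarrow>
     (\<forall>x. (f has_derivative (\<lambda>h. inner (g x) h)) (at x)) \<and> continuous_on UNIV g"

definition absolutely_continuous_on_interval ::
    "real \<Rightarrow> real \<Rightarrow> (real \<Rightarrow> 'a::real_normed_vector) \<Rightarrow> bool" where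
  "absolutely_continuous_on_interval a b f \<longleftrightarrow>
     (\<forall>\<epsilon>>0. \<exists>\<delta>>0. \<forall>(N::nat) (l::nat \<Rightarrow> real) (r::nat \<Rightarrow> real).
        (\<forall>k<N. a \<le> l k \<and> l k \<le> r k \<and> r k \<le> b) \<and>
        (\<forall>j<N. \<forall>k<N. j \<noteq> k \<longrightarrow> {l j<..<r j} \<inter> {l k<..<r k} = {}) \<and>
        (\<Sum>k<N. r k - l k) < \<delta>
        \<longrightarrow> (\<Sum>k<N. norm (f (r k) - f (l k))) < \<epsilon>)"

definition locally_absolutely_continuous_nonneg :: "(real \<Rightarrow> 'a::real_normed_vector) \<Rightarrow> bool" where
  "locally_absolutely_continuous_nonneg f \<longleftrightarrow>
     (\<forall>T\<ge>0. absolutely_continuous_on_interval 0 T f)"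

end

theory Submission
  imports Defs "HOL-Complex_Analysis.Great_Picard"
begin

text \<open>
  Solutions are limits of Moreau's catching-up scheme
  $x^{k+1}_i \in P_\Omega(x^k_i + h F_i(x^k))$. Each correction is a proximal normal of length at most
  $h|F_i|$, so prox-regularity gives, for every $y \in \Omega$,
  $$\frac12\big(|x^{k+1}_i-y|^2 - |x^k_i-y|^2\big)
     \le h\Big(\langle F_i(x^k), x^{k+1}_i-y\rangle + \frac{M}{2\eta}|x^{k+1}_i-y|^2\Big).$$
  This inequality telescopes and involves no velocities, hence it passes to a pointwise limit of the
  equi-Lipschitz schemes. At a time where the Lipschitz limit $x$ is differentiable it says that
  $F_i(x)-\dot x_i$ is normal to $\Omega$ at $x_i$. Since $\Omega$ is prox-regular, the velocity of a curve
  in $\Omega$, and by time reversal also its negative, lies in the Clarke tangent cone, so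
  $\dot x_i$ is the projection of $F_i(x)$. On a bounded $\Omega$ the velocities are bounded by compactness; under linear growth a discrete Gronwall estimate bounds them on finite time intervals.
\<close>

subsection \<open>Lipschitz functions of a real variable are differentiable almost everywhere\<close>

text \<open>Bounded discrete velocities need not converge pointwise, so the equation cannot be
  reached by passing to the limit in them. What survives pointwise convergence of positions is the
  increment of |x - y|^2/2 for each fixed y in \<Omega>. The velocity reappears only as the
  derivative of the limit curve, which is why almost everywhere differentiability of Lipschitz maps
  is needed. The constant 1/(2\<eta>) is what remains after squaring the condition that a ball of
  radius \<eta> touching \<Omega> from outside misses it: normals obey the inequality known from
  convex sets up to a quadratic error, and this error disappears on the infinitesimal scale of
  tangent vectors. Being normal is weaker than being the residue of a projection. The missing piece
  is the orthogonality of F(x) - x' and x', and this is what tangency of both x' and -x'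
  supplies.\<close>

lemma emeasure_countable_UN_le:
  assumes "countable C" "disjoint_family_on X C"
    and "\<And>i. i \<in> C \<Longrightarrow> X i \<in> sets M" "\<And>i. i \<in> C \<Longrightarrow> X i \<in> sets N"
    and le: "\<And>i. i \<in> C \<Longrightarrow> emeasure M (X i) \<le> p * emeasure N (X i)"
  shows "emeasure M (\<Union>i\<in>C. X i) \<le> p * emeasure N (\<Union>i\<in>C. X i)"
proof -
  have "emeasure M (\<Union>i\<in>C. X i) = (\<integral>\<^sup>+i. emeasure M (X i) \<partial>count_space C)"
    using assms by (intro emeasure_UN_countable) auto
  also have "\<dots> \<le> (\<integral>\<^sup>+i. p * emeasure N (X i) \<partial>count_space C)"
    using le by (intro nn_integral_mono) auto
  also have "\<dots> = p * (\<integral>\<^sup>+i. emeasure N (X i) \<partial>count_space C)"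
    by (intro nn_integral_cmult) auto
  also have "(\<integral>\<^sup>+i. emeasure N (X i) \<partial>count_space C) = emeasure N (\<Union>i\<in>C. X i)"
    using assms by (intro emeasure_UN_countable[symmetric]) auto
  finally show ?thesis .
qed

text \<open>On the line a closed interval is the ball about its midpoint, so the ball form of the
  Vitali theorem applies. An interval only has to contain \<open>x\<close>, because a slope interval
  has \<open>x\<close> as an endpoint. Discarding the intervals that leave \<open>U\<close> keeps
  the cover fine, since short ones around \<open>x\<close> stay in the open set.\<close>

lemma Vitali_covering_intervals:
  fixes S U :: "real set"
  assumes "open U" "S \<subseteq> U"
    and fine: "\<And>x e. x \<in> S \<Longrightarrow> e > 0 \<Longrightarrow> \<exists>c d. c < d \<and> c \<le> x \<and> x \<le> d \<and> d - c < e \<and> P c d"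
  obtains C where "countable C" "\<And>c d. (c, d) \<in> C \<Longrightarrow> c < d \<and> P c d \<and> {c..d} \<subseteq> U"
    "disjoint_family_on (\<lambda>(c, d). {c..d}) C" "negligible (S - (\<Union>(c, d)\<in>C. {c..d}))"
proof -
  define K where "K = {(c, d). c < d \<and> P c d \<and> {c..d} \<subseteq> U}"
  define a where "a = (\<lambda>(c::real, d). (c + d) / 2)"
  define r where "r = (\<lambda>(c::real, d). (d - c) / 2)"
  have cb: "cball (a i) (r i) = (case i of (c, d) \<Rightarrow> {c..d})" for i
    by (cases i) (auto simp: a_def r_def cball_eq_atLeastAtMost field_simps)
  have rpos: "0 < r i" if "i \<in> K" for i
    using that by (cases i) (auto simp: r_def K_def)
  have fineK: "\<exists>i. i \<in> K \<and> x \<in> cball (a i) (r i) \<and> r i < d" if "x \<in> S" "0 < d" for x d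
  proof -
    obtain e where e: "e > 0" "ball x e \<subseteq> U"
      using assms(1,2) \<open>x \<in> S\<close> open_contains_ball by blast
    obtain c b where cb': "c < b" "c \<le> x" "x \<le> b" "b - c < min e d" "P c b"
      using fine[OF \<open>x \<in> S\<close>, of "min e d"] e \<open>0 < d\<close> by auto
    have "{c..b} \<subseteq> ball x e"
      using cb' by (auto simp: dist_real_def)
    then have "(c, b) \<in> K" "r (c, b) < d"
      using cb' e \<open>0 < d\<close> by (auto simp: K_def r_def)
    then show ?thesis
      using cb' by (intro exI[of _ "(c, b)"]) (auto simp: cb)
  qed
  obtain C where C: "countable C" "C \<subseteq> K"
     "pairwise (\<lambda>i j. disjnt (cball (a i) (r i)) (cball (a j) (r j))) C"
     "negligible (S - (\<Union>i\<in>C. cball (a i) (r i)))"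
    by (rule Vitali_covering_theorem_cballs[of K r S a, OF rpos fineK])
  show ?thesis
  proof
    show "countable C" by fact
    show "c < d \<and> P c d \<and> {c..d} \<subseteq> U" if "(c, d) \<in> C" for c d
      using that C(2) by (auto simp: K_def)
    show "disjoint_family_on (\<lambda>(c, d). {c..d}) C"
      using C(3) unfolding cb disjoint_family_on_def pairwise_def disjnt_def by auto
    show "negligible (S - (\<Union>(c, d)\<in>C. {c..d}))"
      using C(4) unfolding cb .
  qed
qed

text \<open>The Lebesgue-Stieltjes measure \<nu> of \<open>f\<close> links the two covers: it is at
  most \<open>p\<close> times length on the first, at least \<open>q\<close> times length on the
  second, and the second lies inside the first. As \<open>E\<close> need not be measurable, its size
  is taken as an infimum over measurable supersets.\<close>

lemma negligible_oscillating_slope: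
  fixes f :: "real \<Rightarrow> real" and E :: "real set"
  assumes mono: "\<And>x y. x \<le> y \<Longrightarrow> f x \<le> f y" and cont: "continuous_on UNIV f"
    and pq: "0 < p" "p < q" and "bounded E"
    and small: "\<And>x e. x \<in> E \<Longrightarrow> e > 0 \<Longrightarrow>
      \<exists>c d. c < d \<and> c \<le> x \<and> x \<le> d \<and> d - c < e \<and> f d - f c \<le> p * (d - c)"
    and large: "\<And>x e. x \<in> E \<Longrightarrow> e > 0 \<Longrightarrow>
      \<exists>c d. c < d \<and> c \<le> x \<and> x \<le> d \<and> d - c < e \<and> f d - f c \<ge> q * (d - c)"
  shows "negligible E"
proof (rule ccontr)
  assume nonnegl: "\<not> negligible E"
  \<comment> \<open>Cover \<open>E\<close> by intervals of slope at most \<open>p\<close>, then cover it again inside these by intervals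
    of slope at least \<open>q\<close>: the second cover has smaller measure than the outer measure \<open>s\<close> of \<open>E\<close>.\<close>
  define \<nu> where "\<nu> = interval_measure f"
  have \<nu>: "emeasure \<nu> {c..d} = ennreal (f d - f c)" if "c < d" for c d
    unfolding \<nu>_def using that by (intro emeasure_interval_measure_Icc mono cont) auto
  define \<M> where "\<M> = {T. E \<subseteq> T \<and> T \<in> lmeasurable}"
  define s where "s = (INF T\<in>\<M>. measure lebesgue T)"
  obtain a where "E \<subseteq> cball 0 a"
    using bounded_subset_ballD[OF \<open>bounded E\<close>, of 0] ball_subset_cball by (metis subset_trans)
  then have ne: "\<M> \<noteq> {}"
    unfolding \<M>_def using lmeasurable_cball[of 0 a] by (metis (mono_tags, lifting) empty_iff mem_Collect_eq)
  have bdd: "bdd_below (measure lebesgue ` \<M>)"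
    by (rule bdd_belowI[of _ 0]) auto
  obtain e where "e > 0" and e: "\<And>T. T \<in> \<M> \<Longrightarrow> e \<le> measure lebesgue T"
    using nonnegl unfolding negligible_outer \<M>_def by force
  have "s \<ge> e"
    unfolding s_def by (rule cINF_greatest[OF ne e])
  then have "s > 0" using \<open>e > 0\<close> by simp
  have sle: "s \<le> measure lebesgue T" if "T \<in> \<M>" for T
    unfolding s_def by (rule cINF_lower[OF bdd that])
  \<comment> \<open>The two covers together shrink length by the factor \<open>p / q\<close>; a set
    \<open>U\<close> of length below \<open>s * (q / p)\<close> therefore yields a second cover of
    length below \<open>s\<close>.\<close>
  have "s < s * (q / p)"
    using pq \<open>s > 0\<close> by (simp add: field_simps)
  then obtain T where T: "T \<in> \<M>" "measure lebesgue T < s * (q / p)"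
    unfolding s_def using cINF_less_iff[OF ne bdd] by blast
  then have Tm: "T \<in> lmeasurable" by (simp add: \<M>_def)
  obtain U where U: "open U" "T \<subseteq> U" "U - T \<in> lmeasurable"
      "emeasure lebesgue (U - T) < ennreal (s * (q / p) - measure lebesgue T)"
    using sets_lebesgue_outer_open[of T "s * (q / p) - measure lebesgue T"] T Tm by auto
  have "emeasure lebesgue U = emeasure lebesgue T + emeasure lebesgue (U - T)"
    using U Tm by (subst plus_emeasure) (auto simp: Un_absorb1)
  also have "emeasure lebesgue T = ennreal (measure lebesgue T)"
    using Tm by (simp add: emeasure_eq_measure2)
  also have "ennreal (measure lebesgue T) + emeasure lebesgue (U - T)
      < ennreal (measure lebesgue T) + ennreal (s * (q / p) - measure lebesgue T)"
    using U(4) by (simp add: ennreal_add_left_cancel_less)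
  also have "\<dots> = ennreal (s * (q / p))"
    using T by (subst ennreal_plus[symmetric]) auto
  finally have Umeas: "emeasure lborel U < ennreal (s * (q / p))"
    using \<open>open U\<close> by simp

  have EU: "E \<subseteq> U" using T U by (auto simp: \<M>_def)
  obtain C where C: "countable C"
      "\<And>c d. (c, d) \<in> C \<Longrightarrow> c < d \<and> f d - f c \<le> p * (d - c) \<and> {c..d} \<subseteq> U"
      "disjoint_family_on (\<lambda>(c, d). {c..d}) C" "negligible (E - (\<Union>(c, d)\<in>C. {c..d}))"
    by (rule Vitali_covering_intervals[OF \<open>open U\<close> EU, of "\<lambda>c d. f d - f c \<le> p * (d - c)"])
      (use small in \<open>auto simp: conj_assoc\<close>)
  define I where "I = (\<Union>(c, d)\<in>C. {c..d})"
  \<comment> \<open>Open intervals give the second Vitali cover an open set to stay in; only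
    countably many endpoints are lost.\<close>
  define U' where "U' = (\<Union>(c, d)\<in>C. {c<..<d})"
  have "open U'" unfolding U'_def by (intro open_UN) auto
  have U'I: "U' \<subseteq> I" unfolding U'_def I_def by (intro UN_mono) auto
  have "I \<subseteq> U" using C(2) unfolding I_def by blast
  have "I - U' \<subseteq> fst ` C \<union> snd ` C"
  proof
    fix x assume "x \<in> I - U'"
    then obtain c d where "(c, d) \<in> C" "c \<le> x" "x \<le> d"
      unfolding I_def by auto
    moreover have "\<not> (c < x \<and> x < d)"
      using \<open>x \<in> I - U'\<close> \<open>(c, d) \<in> C\<close> unfolding U'_def by auto
    ultimately have cd: "(c, d) \<in> C" "c \<le> x" "x \<le> d" "\<not> (c < x \<and> x < d)"
      by auto
    then have "x = c \<or> x = d" by auto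
    with cd(1) show "x \<in> fst ` C \<union> snd ` C"
      by (metis Un_iff fst_conv imageI snd_conv)
  qed
  then have "countable (I - U')"
    using C(1) by (meson countable_Un countable_image countable_subset)
  then have "negligible (I - U')" using countable_imp_null_set_lborel negligible_iff_null_sets null_sets_completionI by blast
  then have "negligible ((E - I) \<union> (I - U'))"
    using C(4) unfolding I_def by (intro negligible_Un)
  then have EU': "negligible (E - U')" by (rule negligible_subset) auto

  have Isets: "I \<in> sets borel"
    unfolding I_def using C(1) by (intro sets.countable_UN') auto
  have "emeasure \<nu> I \<le> ennreal p * emeasure lborel I"
    unfolding I_def
  proof (rule emeasure_countable_UN_le[OF C(1,3)])
    fix i assume "i \<in> C"
    then show "emeasure \<nu> (case i of (c, d) \<Rightarrow> {c..d})
        \<le> ennreal p * emeasure lborel (case i of (c, d) \<Rightarrow> {c..d})"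
      using C(2)[of "fst i" "snd i"] pq
      by (cases i) (auto simp: \<nu> ennreal_mult[symmetric] intro!: ennreal_leI)
  qed (auto simp: \<nu>_def split: prod.split)
  also have "\<dots> \<le> ennreal p * emeasure lborel U"
    using \<open>I \<subseteq> U\<close> \<open>open U\<close> by (intro mult_left_mono emeasure_mono) auto
  finally have \<nu>I: "emeasure \<nu> I \<le> ennreal p * emeasure lborel U" .

  obtain D where D: "countable D"
      "\<And>c d. (c, d) \<in> D \<Longrightarrow> c < d \<and> f d - f c \<ge> q * (d - c) \<and> {c..d} \<subseteq> U'"
      "disjoint_family_on (\<lambda>(c, d). {c..d}) D" "negligible (E \<inter> U' - (\<Union>(c, d)\<in>D. {c..d}))"
    by (rule Vitali_covering_intervals[OF \<open>open U'\<close>, of "E \<inter> U'" "\<lambda>c d. f d - f c \<ge> q * (d - c)"])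
      (use large in \<open>auto simp: conj_assoc\<close>)
  define J where "J = (\<Union>(c, d)\<in>D. {c..d})"
  have JU': "J \<subseteq> U'" using D(2) unfolding J_def by blast
  have Jsets: "J \<in> sets borel"
    unfolding J_def using D(1) by (intro sets.countable_UN') auto
  have "emeasure lborel J \<le> ennreal (1 / q) * emeasure \<nu> J"
    unfolding J_def
  proof (rule emeasure_countable_UN_le[OF D(1,3)])
    fix i assume "i \<in> D"
    then show "emeasure lborel (case i of (c, d) \<Rightarrow> {c..d})
        \<le> ennreal (1 / q) * emeasure \<nu> (case i of (c, d) \<Rightarrow> {c..d})"
      using D(2)[of "fst i" "snd i"] pq mono
      by (cases i) (auto simp: \<nu> ennreal_mult[symmetric] field_simps intro!: ennreal_leI)
  qed (auto simp: \<nu>_def split: prod.split)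
  also have "\<dots> \<le> ennreal (1 / q) * emeasure \<nu> I"
    using JU' U'I Isets by (intro mult_left_mono emeasure_mono) (auto simp: \<nu>_def)
  also have "\<dots> \<le> ennreal (1 / q) * (ennreal p * emeasure lborel U)"
    using \<nu>I by (intro mult_left_mono) auto
  also have "\<dots> = ennreal (p / q) * emeasure lborel U"
    using pq by (simp add: mult.assoc[symmetric] ennreal_mult[symmetric])
  also have "\<dots> < ennreal (p / q) * ennreal (s * (q / p))"
    using Umeas pq by (intro ennreal_mult_strict_left_mono) auto
  also have "\<dots> = ennreal s"
    using pq \<open>s > 0\<close> by (subst ennreal_mult[symmetric]) auto
  finally have Jlt: "emeasure lborel J < ennreal s" .
  \<comment> \<open>\<open>J\<close> misses only a null part of \<open>E\<close>. Adding that part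
    back gives a measurable superset of \<open>E\<close> that is too small for the infimum
    \<open>s\<close>.\<close>
  define Z where "Z = E - J"
  have "negligible ((E - U') \<union> (E \<inter> U' - J))"
    using EU' D(4) unfolding J_def by (intro negligible_Un)
  then have Z: "negligible Z"
    unfolding Z_def by (rule negligible_subset) auto
  have J': "J \<in> lmeasurable"
    using Jlt Jsets by (intro fmeasurableI) (auto simp: less_top[symmetric] top_unique)
  have "J \<union> Z \<in> lmeasurable"
    using J' negligible_imp_measurable[OF Z] by (intro fmeasurable.Un)
  then have "J \<union> Z \<in> \<M>"
    unfolding \<M>_def Z_def by auto
  then have "s \<le> measure lebesgue (J \<union> Z)" by (rule sle)
  also have "\<dots> \<le> measure lebesgue J + measure lebesgue Z"
    using J' negligible_imp_measurable[OF Z] by (intro measure_Un_le) auto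
  also have "\<dots> = measure lebesgue J"
    using negligible_imp_measure0[OF Z] by simp
  finally have "ennreal s \<le> emeasure lebesgue J"
    using J' by (simp add: emeasure_eq_measure2 ennreal_leI)
  with Jlt Jsets show False by simp
qed


text \<open>Where the derivative fails to exist, the slopes at \<open>x\<close> fall infinitely
  often below a rational \<open>p\<close> and rise above a rational \<open>q > p\<close>: they are
  confined to the interval from 0 to \<open>L\<close>, so they cannot run off to infinity. This
  leaves countably many exceptional sets, cut to bounded pieces by \<open>k\<close>.\<close>

lemma negligible_not_differentiable_mono_Lipschitz:
  fixes f :: "real \<Rightarrow> real"
  assumes mono: "\<And>x y. x \<le> y \<Longrightarrow> f x \<le> f y"
    and lip: "\<And>x y. \<bar>f x - f y\<bar> \<le> L * \<bar>x - y\<bar>"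
  shows "negligible {x. \<not> f differentiable (at x)}"
proof -
  define S where "S = (\<lambda>x y. (f y - f x) / (y - x))"
  have "L \<ge> 0" using lip[of 0 1] by simp
  have cont: "continuous_on UNIV f"
  proof (rule lipschitz_on_continuous_on[of L])
    show "L-lipschitz_on UNIV f"
      using lip \<open>L \<ge> 0\<close> by (intro lipschitz_onI) (auto simp: dist_real_def)
  qed
  have S_nonneg: "0 \<le> S x y" for x y
    using mono[of x y] mono[of y x] by (cases "x \<le> y") (auto simp: S_def divide_nonpos_nonpos)
  have S_le: "S x y \<le> L" for x y
  proof (cases "x = y")
    case False
    have "S x y \<le> \<bar>f y - f x\<bar> / \<bar>y - x\<bar>"
      unfolding S_def by (metis abs_divide abs_ge_self)
    also have "\<dots> \<le> L"
      using lip[of y x] False by (simp add: divide_le_eq)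
    finally show ?thesis .
  qed (use \<open>L \<ge> 0\<close> in \<open>auto simp: S_def\<close>)
  define E where "E = (\<lambda>p q (k::nat). {x. \<bar>x\<bar> \<le> real k \<and>
    frequently (\<lambda>y. S x y < p) (at x) \<and> frequently (\<lambda>y. S x y > q) (at x)})"
  have slope: "\<exists>c d. c < d \<and> c \<le> x \<and> x \<le> d \<and> d - c < e \<and> Q ((f d - f c) / (d - c))"
    if "frequently (\<lambda>y. Q (S x y)) (at x)" "e > 0" for x e Q
  proof -
    have "eventually (\<lambda>y. dist y x < e \<and> y \<noteq> x) (at x)"
      unfolding eventually_at using \<open>e > 0\<close> by auto
    then have "frequently (\<lambda>y. Q (S x y) \<and> dist y x < e \<and> y \<noteq> x) (at x)"
      using that(1) frequently_rev_mp eventually_mono by (smt (verit, best))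
    then obtain y where y: "Q (S x y)" "dist y x < e" "y \<noteq> x"
      using frequently_ex by blast
    have "S x y = S y x" unfolding S_def by (metis minus_diff_eq minus_divide_divide)
    then show ?thesis
      using y by (intro exI[of _ "min x y"] exI[of _ "max x y"])
        (auto simp: S_def min_def max_def dist_real_def)
  qed
  have neg: "negligible (E p q k)" if "0 < p" "p < q" for p q k
  proof (rule negligible_oscillating_slope[OF mono cont that])
    show "bounded (E p q k)"
      by (rule boundedI[of _ "real k"]) (auto simp: E_def)
    fix x and e :: real assume "x \<in> E p q k" "e > 0"
    then obtain c d where "c < d" "c \<le> x" "x \<le> d" "d - c < e" "(f d - f c) / (d - c) < p"
      using slope[of "\<lambda>s. s < p" x e] unfolding E_def by auto
    then show "\<exists>c d. c < d \<and> c \<le> x \<and> x \<le> d \<and> d - c < e \<and> f d - f c \<le> p * (d - c)"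
      by (intro exI[of _ c] exI[of _ d]) (auto simp: field_simps)
  next
    fix x and e :: real assume "x \<in> E p q k" "e > 0"
    then obtain c d where "c < d" "c \<le> x" "x \<le> d" "d - c < e" "(f d - f c) / (d - c) > q"
      using slope[of "\<lambda>s. s > q" x e] unfolding E_def by auto
    then show "\<exists>c d. c < d \<and> c \<le> x \<and> x \<le> d \<and> d - c < e \<and> f d - f c \<ge> q * (d - c)"
      by (intro exI[of _ c] exI[of _ d]) (auto simp: field_simps)
  qed
  define R where "R = {(p :: real, q, k). p \<in> \<rat> \<and> q \<in> \<rat> \<and> 0 < p \<and> p < q \<and> k \<in> (UNIV :: nat set)}"
  have "R \<subseteq> \<rat> \<times> \<rat> \<times> UNIV" by (auto simp: R_def)
  then have "countable R"
    by (rule countable_subset) (intro countable_SIGMA countable_rat countableI_type)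
  then have "negligible (\<Union>((\<lambda>(p, q, k). E p q k) ` R))"
    by (intro negligible_countable_Union) (auto simp: R_def neg)
  moreover have "{x. \<not> f differentiable (at x)} \<subseteq> \<Union>((\<lambda>(p, q, k). E p q k) ` R)"
  proof
    fix x assume "x \<in> {x. \<not> f differentiable (at x)}"
    then have nd: "\<not> f differentiable (at x)" by simp
    \<comment> \<open>\<open>l\<close> is the lower limit of the slopes at \<open>x\<close>, written
      as the supremum of their eventual lower bounds. If they did not frequently reach some
      \<open>l + e\<close>, they would converge to \<open>l\<close> and the derivative would
      exist.\<close>
    define A where "A = {p. eventually (\<lambda>y. p \<le> S x y) (at x)}"
    define l where "l = Sup A"
    have "0 \<in> A" by (auto simp: A_def S_nonneg)
    have A_le: "p \<le> L" if "p \<in> A" for p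
    proof -
      obtain y where "p \<le> S x y"
        using \<open>p \<in> A\<close> eventually_happens'[OF at_neq_bot, of "\<lambda>y. p \<le> S x y" x] by (auto simp: A_def)
      then show ?thesis using S_le[of x y] by simp
    qed
    then have bdd: "bdd_above A" by (rule bdd_aboveI)
    have "l \<ge> 0" unfolding l_def by (rule cSup_upper[OF \<open>0 \<in> A\<close> bdd])
    have below: "eventually (\<lambda>y. l - e < S x y) (at x)" if "e > 0" for e
    proof -
      obtain p where "p \<in> A" "l - e < p"
        using \<open>e > 0\<close> less_cSup_iff[of A "l - e"] bdd \<open>0 \<in> A\<close> unfolding l_def by auto
      then show ?thesis unfolding A_def by (auto elim: eventually_mono)
    qed
    have "\<exists>e>0. frequently (\<lambda>y. l + e \<le> S x y) (at x)"
    proof (rule ccontr)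
      assume "\<not> ?thesis"
      then have above: "eventually (\<lambda>y. S x y < l + e) (at x)" if "e > 0" for e
        using that by (auto simp: frequently_def not_le)
      have "(S x \<longlongrightarrow> l) (at x)"
      proof (rule tendstoI)
        fix e :: real assume "e > 0"
        from below[OF this] above[OF this] show "eventually (\<lambda>y. dist (S x y) l < e) (at x)"
          by eventually_elim (auto simp: dist_real_def)
      qed
      then have "(f has_field_derivative l) (at x)"
        unfolding has_field_derivative_iff S_def .
      with nd show False
        using real_differentiable_def by blast
    qed
    then obtain e where e: "e > 0" "frequently (\<lambda>y. l + e \<le> S x y) (at x)" by blast
    obtain p where p: "p \<in> \<rat>" "l < p" "p < l + e"
      using Rats_dense_in_real[of l "l + e"] e by auto
    obtain q where q: "q \<in> \<rat>" "p < q" "q < l + e"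
      using Rats_dense_in_real[of p "l + e"] p by auto
    have "p \<notin> A"
      using p(2) cSup_upper[OF _ bdd] unfolding l_def by force
    then have "frequently (\<lambda>y. S x y < p) (at x)"
      by (auto simp: A_def frequently_def not_less)
    moreover have "frequently (\<lambda>y. S x y > q) (at x)"
      using e(2) by (rule frequently_elim1) (use q in auto)
    moreover obtain k :: nat where "\<bar>x\<bar> \<le> real k"
      using real_arch_simple by blast
    ultimately have "x \<in> E p q k" "(p, q, k) \<in> R"
      using p q \<open>l \<ge> 0\<close> by (auto simp: E_def R_def)
    then show "x \<in> \<Union>((\<lambda>(p, q, k). E p q k) ` R)" by blast
  qed
  ultimately show ?thesis by (rule negligible_subset)
qed

text \<open>Adding \<open>L * x\<close> makes the function increasing, with constant
  \<open>2 * L\<close>, and does not change where it is differentiable.\<close>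

lemma negligible_not_differentiable_Lipschitz:
  fixes f :: "real \<Rightarrow> real"
  assumes lip: "\<And>x y. \<bar>f x - f y\<bar> \<le> L * \<bar>x - y\<bar>"
  shows "negligible {x. \<not> f differentiable (at x)}"
proof -
  define g where "g = (\<lambda>x. f x + L * x)"
  have "g x \<le> g y" if "x \<le> y" for x y
    using lip[of x y] that by (auto simp: g_def algebra_simps abs_le_iff)
  moreover have "\<bar>g x - g y\<bar> \<le> (2 * L) * \<bar>x - y\<bar>" for x y
  proof -
    have "L \<ge> 0" using lip[of 0 1] by simp
    have "\<bar>g x - g y\<bar> \<le> \<bar>f x - f y\<bar> + \<bar>L * (x - y)\<bar>"
      by (simp add: g_def algebra_simps)
    then show ?thesis using lip[of x y] \<open>L \<ge> 0\<close> by (simp add: abs_mult)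
  qed
  ultimately have "negligible {x. \<not> g differentiable (at x)}"
    by (rule negligible_not_differentiable_mono_Lipschitz)
  moreover have "f differentiable (at x)" if "g differentiable (at x)" for x
  proof -
    have "(\<lambda>x. g x - L * x) differentiable (at x)"
      using that by (intro differentiable_diff differentiable_mult) auto
    then show ?thesis by (simp add: g_def)
  qed
  ultimately show ?thesis
    by (rule_tac negligible_subset) auto
qed

lemma negligible_not_differentiable_Lipschitz_interval:
  fixes f :: "real \<Rightarrow> 'a::euclidean_space"
  assumes lip: "\<And>x y. x \<in> {a..b} \<Longrightarrow> y \<in> {a..b} \<Longrightarrow> norm (f x - f y) \<le> L * \<bar>x - y\<bar>"
  shows "negligible {x \<in> {a<..<b}. \<not> f differentiable (at x)}"
proof (cases "a < b")
  case True
  have "L \<ge> 0"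
    using lip[of a b] True norm_ge_zero[of "f a - f b"] by (smt (verit) atLeastAtMost_iff mult_neg_pos)
  \<comment> \<open>Clamping to \<open>{a..b}\<close> does not increase distances, so it extends
    \<open>f\<close> to the whole line with the same constant; near an interior point nothing
    changes.\<close>
  define c where "c = (\<lambda>x. max a (min b x))"
  have c: "c x \<in> {a..b}" "\<bar>c x - c y\<bar> \<le> \<bar>x - y\<bar>" for x y
    using True by (auto simp: c_def)
  have neg: "negligible {x. \<not> (\<lambda>x. f (c x) \<bullet> i) differentiable (at x)}" if "i \<in> Basis" for i
  proof (rule negligible_not_differentiable_Lipschitz[of _ L])
    fix x y
    have "\<bar>f (c x) \<bullet> i - f (c y) \<bullet> i\<bar> \<le> norm (f (c x) - f (c y))"
      using Basis_le_norm[OF that, of "f (c x) - f (c y)"] by (simp add: inner_diff_left)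
    also have "\<dots> \<le> L * \<bar>c x - c y\<bar>" by (intro lip c)
    also have "\<dots> \<le> L * \<bar>x - y\<bar>" using c \<open>L \<ge> 0\<close> by (intro mult_left_mono)
    finally show "\<bar>f (c x) \<bullet> i - f (c y) \<bullet> i\<bar> \<le> L * \<bar>x - y\<bar>" .
  qed
  have "negligible (\<Union>i\<in>Basis. {x. \<not> (\<lambda>x. f (c x) \<bullet> i) differentiable (at x)})"
    using neg by (intro negligible_Union) auto
  moreover have "{x \<in> {a<..<b}. \<not> f differentiable (at x)} \<subseteq>
      (\<Union>i\<in>Basis. {x. \<not> (\<lambda>x. f (c x) \<bullet> i) differentiable (at x)})"
  proof
    fix x assume x: "x \<in> {x \<in> {a<..<b}. \<not> f differentiable (at x)}"
    show "x \<in> (\<Union>i\<in>Basis. {x. \<not> (\<lambda>x. f (c x) \<bullet> i) differentiable (at x)})"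
    proof (rule ccontr)
      assume "\<not> ?thesis"
      then have "(\<lambda>x. f (c x)) differentiable (at x)"
        by (subst differentiable_componentwise_within) auto
      then obtain D where D: "((\<lambda>x. f (c x)) has_derivative D) (at x)"
        by (auto simp: differentiable_def)
      have "(f has_derivative D) (at x)"
        by (rule has_derivative_transform_within_open[OF D, of "{a<..<b}"])
          (use x in \<open>auto simp: c_def\<close>)
      with x show False by (auto simp: differentiable_def)
    qed
  qed
  ultimately show ?thesis by (rule negligible_subset)
qed auto

subsection \<open>Prox-regular sets\<close>

text \<open>An interior point could be moved a little towards \<open>a\<close> inside
  \<open>S\<close> and become nearer. This is needed because \<open>prox_regular\<close> speaks only
  of normals at frontier points.\<close>

lemma nearest_points_frontier:
  assumes "x \<in> nearest_points S a" "a \<noteq> x"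
  shows "x \<in> frontier S"
proof -
  have "x \<in> S" and near: "\<And>w. w \<in> S \<Longrightarrow> dist a x \<le> dist a w"
    using assms(1) by (auto simp: nearest_points_def)
  have "x \<notin> interior S"
  proof
    assume "x \<in> interior S"
    then obtain e where "e > 0" and e: "ball x e \<subseteq> S"
      by (auto simp: mem_interior)
    define t where "t = min (1/2) (e / (2 * dist a x))"
    have d: "dist a x > 0" using assms(2) by simp
    have t: "0 < t" "t < 1" using \<open>e > 0\<close> d by (auto simp: t_def)
    have "t * dist a x \<le> e / (2 * dist a x) * dist a x"
      using d by (intro mult_right_mono) (auto simp: t_def)
    also have "\<dots> = e / 2" using d by simp
    finally have "t * dist a x < e" using \<open>e > 0\<close> by simp
    then have "x + t *\<^sub>R (a - x) \<in> ball x e"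
      using t by (simp add: dist_norm norm_minus_commute)
    then have "dist a x \<le> dist a (x + t *\<^sub>R (a - x))"
      using e near by blast
    also have "a - (x + t *\<^sub>R (a - x)) = (1 - t) *\<^sub>R (a - x)"
      by (simp add: algebra_simps)
    then have "dist a (x + t *\<^sub>R (a - x)) = (1 - t) * dist a x"
      using t by (simp add: dist_norm)
    finally have "t * dist a x \<le> 0" by (simp add: algebra_simps)
    with t d show False by (simp add: mult_le_0_iff)
  qed
  then show ?thesis
    using \<open>x \<in> S\<close> closure_subset by (auto simp: frontier_def)
qed

text \<open>For the unit normal \<open>v\<close>, that \<open>z\<close> avoids the ball reads |z - y
  - \<eta> v| \<ge> \<eta>. Squaring cancels the square of \<eta> and leaves <v, z - y> \<le> |z -
  y|^2/(2\<eta>); multiplying by |a - y| undoes the normalization.\<close>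

lemma prox_regular_nearest_point_inner_le:
  assumes prox: "prox_regular \<eta> S" and "\<eta> > 0"
    and y: "y \<in> nearest_points S a" and "z \<in> S"
  shows "inner (a - y) (z - y) \<le> norm (a - y) / (2 * \<eta>) * (norm (z - y))\<^sup>2"
proof (cases "a = y")
  case False
  define r where "r = norm (a - y)"
  define v where "v = (1 / r) *\<^sub>R (a - y)"
  have r: "r > 0" using False by (simp add: r_def)
  have "a = y + r *\<^sub>R v" using r by (simp add: v_def)
  then have "v \<in> proximal_normal_cone S y"
    using y r unfolding proximal_normal_cone_def by auto
  moreover have v1: "norm v = 1" using r by (simp add: v_def r_def)
  ultimately have "ball (y + \<eta> *\<^sub>R v) \<eta> \<inter> S = {}"
    using prox nearest_points_frontier[OF y False] unfolding prox_regular_def by blast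
  then have "\<eta> \<le> norm ((z - y) - \<eta> *\<^sub>R v)"
    using \<open>z \<in> S\<close> by (force simp: dist_norm norm_minus_commute algebra_simps)
  then have "\<eta>\<^sup>2 \<le> (norm ((z - y) - \<eta> *\<^sub>R v))\<^sup>2"
    using \<open>\<eta> > 0\<close> by (intro power_mono) auto
  also have "\<dots> = (norm (z - y))\<^sup>2 - 2 * \<eta> * inner v (z - y) + \<eta>\<^sup>2 * (norm v)\<^sup>2"
    unfolding power2_norm_eq_inner
    by (simp add: inner_diff_left inner_diff_right inner_commute power2_eq_square algebra_simps)
  finally have "inner v (z - y) \<le> (norm (z - y))\<^sup>2 / (2 * \<eta>)"
    using v1 \<open>\<eta> > 0\<close> by (simp add: field_simps)
  then have "r * inner v (z - y) \<le> r * ((norm (z - y))\<^sup>2 / (2 * \<eta>))"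
    using r by (intro mult_left_mono) auto
  then show ?thesis using r by (simp add: v_def r_def)
qed simp

section \<open>Tangent directions and projection onto the tangent cone\<close>

lemma closest_point_nearest_points:
  assumes "closed S" "S \<noteq> {}"
  shows "closest_point S a \<in> nearest_points S a"
  using closest_point_exists[OF assms, of a] by (auto simp: nearest_points_def)

text \<open>\<open>closest_point\<close> is a choice among minimizers, so its value is pinned down
  only by uniqueness; the Pythagorean inequality \<open>*\<close> gives minimality and uniqueness
  together. Starting from the obtuse angle avoids having to show that the Clarke cone is closed and
  convex.\<close>

lemma closest_point_eqI:
  fixes a x :: "'a::euclidean_space"
  assumes "x \<in> S" and obtuse: "\<And>w. w \<in> S \<Longrightarrow> inner (a - x) (w - x) \<le> 0"
  shows "closest_point S a = x"
proof -
  have *: "(dist a x)\<^sup>2 + (dist x w)\<^sup>2 \<le> (dist a w)\<^sup>2" if "w \<in> S" for w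
    using obtuse[OF that]
    by (simp add: dist_norm power2_norm_eq_inner inner_diff_left inner_diff_right inner_commute)
  show ?thesis
    unfolding closest_point_def
  proof (rule some_equality)
    show "x \<in> S \<and> (\<forall>y\<in>S. dist a x \<le> dist a y)"
    proof (intro conjI ballI \<open>x \<in> S\<close>)
      fix y assume "y \<in> S"
      have "(dist a x)\<^sup>2 \<le> (dist a y)\<^sup>2"
        using *[OF \<open>y \<in> S\<close>] zero_le_power2[of "dist x y"] by linarith
      then show "dist a x \<le> dist a y"
        by (rule power2_le_imp_le) simp
    qed
  next
    fix w assume w: "w \<in> S \<and> (\<forall>y\<in>S. dist a w \<le> dist a y)"
    then have "(dist a w)\<^sup>2 \<le> (dist a x)\<^sup>2"
      using \<open>x \<in> S\<close> by (intro power_mono) auto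
    with *[of w] w have "(dist x w)\<^sup>2 \<le> 0" by linarith
    then show "w = x" by simp
  qed
qed

text \<open>The points \<open>xs k + t k *\<^sub>R w\<close> are projected back to \<Omega>. The
  residue is \<open>t k *\<^sub>R u k\<close> with \<open>u k\<close> normal at \<open>y k\<close>,
  and the velocities \<open>w - u k\<close> lead into \<Omega>, so everything rests on
  \<open>u k\<close> tending to 0. The square of its norm is at most <u k, w> up to O(t k), and <u
  k, w> has no positive limit point because the curve leaves \<open>x r\<close> inside \<Omega> with
  velocity \<open>w\<close>.\<close>

lemma prox_regular_derivative_in_tangent_cone:
  fixes \<Omega> :: "'a::euclidean_space set" and x :: "real \<Rightarrow> 'a"
  assumes "closed \<Omega>" "\<eta> > 0" and prox: "prox_regular \<eta> \<Omega>"
    and deriv: "(x has_vector_derivative w) (at r)"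
    and in\<Omega>: "eventually (\<lambda>t. x t \<in> \<Omega>) (nhds r)"
  shows "w \<in> clarke_tangent_cone \<Omega> (x r)"
  unfolding clarke_tangent_cone_def
proof (intro CollectI allI impI)
  fix t :: "nat \<Rightarrow> real" and xs :: "nat \<Rightarrow> 'a"
  assume A: "(\<forall>k. t k > 0) \<and> t \<longlonglongrightarrow> 0 \<and> (\<forall>k. xs k \<in> \<Omega>) \<and> xs \<longlonglongrightarrow> x r"
  then have tpos: "\<And>k. t k > 0" and t0: "t \<longlonglongrightarrow> 0" and xs\<Omega>: "\<And>k. xs k \<in> \<Omega>"
    and xslim: "xs \<longlonglongrightarrow> x r" by auto
  define y where "y k = closest_point \<Omega> (xs k + t k *\<^sub>R w)" for k
  define u where "u k = (1 / t k) *\<^sub>R (xs k + t k *\<^sub>R w - y k)" for k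
  define c where "c = norm w / (2 * \<eta>)"
  have "c \<ge> 0" using \<open>\<eta> > 0\<close> by (simp add: c_def)
  have y: "y k \<in> nearest_points \<Omega> (xs k + t k *\<^sub>R w)" for k
    unfolding y_def using xs\<Omega> \<open>closed \<Omega>\<close> by (intro closest_point_nearest_points) auto
  have tu: "t k *\<^sub>R u k = xs k + t k *\<^sub>R w - y k" for k
    using tpos[of k] by (simp add: u_def)
  have tu_le: "norm (t k *\<^sub>R u k) \<le> t k * norm w" for k
  proof -
    have "dist (xs k + t k *\<^sub>R w) (y k) \<le> dist (xs k + t k *\<^sub>R w) (xs k)"
      using y[of k] xs\<Omega>[of k] by (auto simp: nearest_points_def)
    then show ?thesis using tpos[of k] unfolding tu dist_norm by simp
  qed
  have u_le: "norm (u k) \<le> norm w" for k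
    using tu_le[of k] tpos[of k] by simp
  have normal: "inner (u k) (z - y k) \<le> c * (norm (z - y k))\<^sup>2" if "z \<in> \<Omega>" for z k
  proof -
    have "t k * inner (u k) (z - y k) = inner (t k *\<^sub>R u k) (z - y k)" by simp
    also have "\<dots> \<le> norm (t k *\<^sub>R u k) / (2 * \<eta>) * (norm (z - y k))\<^sup>2"
      unfolding tu by (rule prox_regular_nearest_point_inner_le[OF prox \<open>\<eta> > 0\<close> y that])
    also have "\<dots> \<le> t k * norm w / (2 * \<eta>) * (norm (z - y k))\<^sup>2"
      using tu_le[of k] \<open>\<eta> > 0\<close> by (intro mult_right_mono divide_right_mono) auto
    also have "\<dots> = t k * (c * (norm (z - y k))\<^sup>2)" by (simp add: c_def)
    finally show ?thesis using tpos[of k] by simp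
  qed
  have xy: "norm (xs k - y k) \<le> 2 * norm w * t k" for k
  proof -
    have "xs k - y k = t k *\<^sub>R u k - t k *\<^sub>R w" unfolding tu by simp
    then have "norm (xs k - y k) \<le> norm (t k *\<^sub>R u k) + norm (t k *\<^sub>R w)"
      by (metis norm_triangle_ineq4)
    also have "norm (t k *\<^sub>R w) = t k * norm w" using tpos[of k] by simp
    finally have "norm (xs k - y k) \<le> t k * norm w + t k * norm w"
      using tu_le[of k] by linarith
    then show ?thesis by (simp add: algebra_simps)
  qed
  have "(\<lambda>k. xs k - y k) \<longlonglongrightarrow> 0"
  proof (rule Lim_null_comparison)
    show "(\<lambda>k. 2 * norm w * t k) \<longlonglongrightarrow> 0"
      using tendsto_mult[OF tendsto_const[of "2 * norm w"] t0] by simp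
  qed (use xy in auto)
  from tendsto_diff[OF xslim this] have ylim: "y \<longlonglongrightarrow> x r" by simp

  \<comment> \<open>In the limit the normals \<open>u k\<close> at \<open>y k\<close> become normal at \<open>x r\<close>; test them against the points \<open>x s\<close> with \<open>s\<close> close to \<open>r\<close>.\<close>
  have uw: "eventually (\<lambda>k. inner (u k) w \<le> e) sequentially" if "e > 0" for e
  proof -
    define q where "q s = (x s - x r) /\<^sub>R (s - r)" for s
    have q: "(q \<longlongrightarrow> w) (at_right r)"
    proof -
      have "((\<lambda>s. (x s - x r - (s - r) *\<^sub>R w) /\<^sub>R norm (s - r)) \<longlongrightarrow> 0) (at_right r)"
        using has_vector_derivative_at_within[OF deriv]
        unfolding has_vector_derivative_def has_derivative_at_within by blast
      then have "((\<lambda>s. (x s - x r - (s - r) *\<^sub>R w) /\<^sub>R norm (s - r) + w) \<longlongrightarrow> 0 + w) (at_right r)"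
        by (intro tendsto_intros)
      moreover have "eventually (\<lambda>s. (x s - x r - (s - r) *\<^sub>R w) /\<^sub>R norm (s - r) + w = q s) (at_right r)"
        unfolding eventually_at_filter by (auto simp: q_def scaleR_diff_right)
      ultimately show ?thesis
        using Lim_transform_eventually by fastforce
    qed
    have "((\<lambda>s. norm w * norm (w - q s) + c * (s - r) * (norm (q s))\<^sup>2) \<longlongrightarrow>
        norm w * norm (w - w) + c * (r - r) * (norm w)\<^sup>2) (at_right r)"
      by (intro tendsto_intros q)
    then have "eventually (\<lambda>s. norm w * norm (w - q s) + c * (s - r) * (norm (q s))\<^sup>2 < e) (at_right r)"
      using \<open>e > 0\<close> by (intro order_tendstoD) auto
    moreover have "eventually (\<lambda>s. x s \<in> \<Omega>) (at_right r)"
      using in\<Omega> by (auto simp: eventually_at_filter elim: eventually_mono)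
    moreover have "eventually (\<lambda>s. s > r) (at_right r)"
      by (auto simp: eventually_at_filter)
    ultimately have "eventually (\<lambda>s. norm w * norm (w - q s) + c * (s - r) * (norm (q s))\<^sup>2 < e
        \<and> x s \<in> \<Omega> \<and> s > r) (at_right r)"
      by eventually_elim auto
    then obtain s where s: "norm w * norm (w - q s) + c * (s - r) * (norm (q s))\<^sup>2 < e"
        "x s \<in> \<Omega>" "s > r"
      using eventually_happens trivial_limit_at_right_real by blast
    \<comment> \<open>Here \<open>(s - r) *\<^sub>R w\<close> is split into
      \<open>(s - r) *\<^sub>R (w - q s)\<close>, \<open>x s - y k\<close> and
      \<open>y k - x r\<close>, each paired with \<open>u k\<close>. The time \<open>s\<close> is
      fixed before \<open>k\<close> grows: the last term then vanishes and the others tend to the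
      quantity already made smaller than \<open>e\<close>.\<close>
    define b where "b k = norm w * norm (w - q s) + c * (norm (x s - y k))\<^sup>2 / (s - r)
      + norm w * norm (y k - x r) / (s - r)" for k
    have "b \<longlonglongrightarrow> norm w * norm (w - q s) + c * (norm (x s - x r))\<^sup>2 / (s - r)
      + norm w * norm (x r - x r) / (s - r)"
      unfolding b_def using s(3) by (intro tendsto_intros ylim) auto
    moreover have "c * (norm (x s - x r))\<^sup>2 / (s - r) = c * (s - r) * (norm (q s))\<^sup>2"
      using s(3) by (simp add: q_def power_mult_distrib power2_eq_square divide_simps)
    ultimately have "eventually (\<lambda>k. b k < e) sequentially"
      using s(1) by (intro order_tendstoD(2)) auto
    moreover have "inner (u k) w \<le> b k" for k
    proof -
      have "x s - x r = (s - r) *\<^sub>R q s"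
        using s(3) by (simp add: q_def)
      then have "(s - r) *\<^sub>R w = (s - r) *\<^sub>R (w - q s) + (x s - y k) + (y k - x r)"
        by (simp add: algebra_simps)
      then have "(s - r) * inner (u k) w
          = (s - r) * inner (u k) (w - q s) + inner (u k) (x s - y k) + inner (u k) (y k - x r)"
        by (metis inner_add_right inner_scaleR_right)
      also have "inner (u k) (w - q s) \<le> norm w * norm (w - q s)"
        using u_le[of k] norm_cauchy_schwarz[of "u k" "w - q s"]
        by (meson mult_right_mono norm_ge_zero order_trans)
      also have "inner (u k) (x s - y k) \<le> c * (norm (x s - y k))\<^sup>2"
        by (rule normal[OF s(2)])
      also have "inner (u k) (y k - x r) \<le> norm w * norm (y k - x r)"
        using u_le[of k] norm_cauchy_schwarz[of "u k" "y k - x r"]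
        by (meson mult_right_mono norm_ge_zero order_trans)
      finally have "(s - r) * inner (u k) w \<le> (s - r) * b k"
        using s(3) by (simp add: b_def distrib_left mult_left_mono)
      then show ?thesis using s(3) by simp
    qed
    ultimately show ?thesis
      by (auto elim!: eventually_mono intro: order_trans less_imp_le)
  qed
  \<comment> \<open>Normality at \<open>y k\<close> is tested at \<open>xs k\<close>, a point of
    \<Omega> at distance O(t k); the quadratic error is still O(t k) after division by
    \<open>t k\<close>.\<close>
  have u_sq: "(norm (u k))\<^sup>2 \<le> inner (u k) w + c * (4 * (norm w)\<^sup>2) * t k" for k
  proof -
    have "t k * (norm (u k))\<^sup>2 = inner (u k) (t k *\<^sub>R u k)"
      by (simp add: power2_norm_eq_inner)
    also have "\<dots> = t k * inner (u k) w + inner (u k) (xs k - y k)"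
      unfolding tu by (simp add: algebra_simps)
    also have "inner (u k) (xs k - y k) \<le> c * (norm (xs k - y k))\<^sup>2"
      by (rule normal[OF xs\<Omega>])
    also have "\<dots> \<le> c * (2 * norm w * t k)\<^sup>2"
      using xy \<open>c \<ge> 0\<close> by (intro mult_left_mono power_mono) auto
    also have "\<dots> = t k * (c * (4 * (norm w)\<^sup>2) * t k)"
      by (simp add: power2_eq_square)
    finally have "t k * (norm (u k))\<^sup>2 \<le> t k * (inner (u k) w + c * (4 * (norm w)\<^sup>2) * t k)"
      by (simp add: algebra_simps)
    then show ?thesis using tpos[of k] by simp
  qed
  have "(\<lambda>k. (norm (u k))\<^sup>2) \<longlonglongrightarrow> 0"
  proof (rule tendstoI)
    fix e :: real assume "e > 0"
    have "(\<lambda>k. c * (4 * (norm w)\<^sup>2) * t k) \<longlonglongrightarrow> 0"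
      using tendsto_mult[OF tendsto_const[of "c * (4 * (norm w)\<^sup>2)"] t0] by simp
    then have "eventually (\<lambda>k. c * (4 * (norm w)\<^sup>2) * t k < e / 2) sequentially"
      using \<open>e > 0\<close> by (intro order_tendstoD) auto
    moreover have "eventually (\<lambda>k. inner (u k) w \<le> e / 2) sequentially"
      using uw[of "e / 2"] \<open>e > 0\<close> by simp
    ultimately show "eventually (\<lambda>k. dist ((norm (u k))\<^sup>2) 0 < e) sequentially"
    proof eventually_elim
      case (elim k)
      then have "(norm (u k))\<^sup>2 < e" using u_sq[of k] by linarith
      then show ?case by simp
    qed
  qed
  then have "u \<longlonglongrightarrow> 0"
    by (simp add: tendsto_norm_zero_iff)
  then have "(\<lambda>k. w - u k) \<longlonglongrightarrow> w - 0" by (intro tendsto_intros)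
  moreover have "xs k + t k *\<^sub>R (w - u k) \<in> \<Omega>" for k
    using y[of k] tu[of k] by (simp add: nearest_points_def scaleR_diff_right)
  ultimately show "\<exists>vs. vs \<longlonglongrightarrow> w \<and> (\<forall>k. xs k + t k *\<^sub>R vs k \<in> \<Omega>)"
    by auto
qed


text \<open>The normal inequality makes <f - w, v> nonpositive for every tangent \<open>v\<close>.
  Used with \<open>-w\<close> it gives <f - w, w> \<ge> 0, and subtracting yields the obtuse angle
  at \<open>w\<close>. Reversing time is the reason why the curve has to lie in \<Omega> on both
  sides of \<open>r\<close>.\<close>

lemma tangent_proj_eq_derivative:
  fixes \<Omega> :: "'a::euclidean_space set" and x :: "real \<Rightarrow> 'a"
  assumes "closed \<Omega>" "\<eta> > 0" "prox_regular \<eta> \<Omega>"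
    and deriv: "(x has_vector_derivative w) (at r)"
    and in\<Omega>: "eventually (\<lambda>t. x t \<in> \<Omega>) (nhds r)"
    and normal: "\<And>y. y \<in> \<Omega> \<Longrightarrow> inner (f - w) (y - x r) \<le> c * (norm (y - x r))\<^sup>2"
  shows "tangent_proj \<Omega> (x r) f = w"
  unfolding tangent_proj_def
proof (rule closest_point_eqI)
  show "w \<in> clarke_tangent_cone \<Omega> (x r)"
    by (rule prox_regular_derivative_in_tangent_cone) fact+
  have xr: "x r \<in> \<Omega>" using in\<Omega> by (rule eventually_nhds_x_imp_x)
  have tang: "inner (f - w) v \<le> 0" if "v \<in> clarke_tangent_cone \<Omega> (x r)" for v
  proof -
    \<comment> \<open>The Clarke condition is applied with constant base points; dividing the
      quadratic bound by the step leaves a factor \<open>1 / real (Suc k)\<close> that tends to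
      0.\<close>
    have "\<exists>vs. vs \<longlonglongrightarrow> v \<and> (\<forall>k. x r + (1 / real (Suc k)) *\<^sub>R vs k \<in> \<Omega>)"
      using that[unfolded clarke_tangent_cone_def, simplified, rule_format, of "\<lambda>k. 1 / real (Suc k)" "\<lambda>_. x r"]
        xr lim_1_over_n[THEN LIMSEQ_Suc] by auto
    then obtain vs where vs: "vs \<longlonglongrightarrow> v" "\<And>k. x r + (1 / real (Suc k)) *\<^sub>R vs k \<in> \<Omega>" by blast
    have le: "inner (f - w) (vs k) \<le> c * (1 / real (Suc k)) * (norm (vs k))\<^sup>2" for k
    proof -
      define t where "t = 1 / real (Suc k)"
      have "t > 0" by (simp add: t_def)
      have "t * inner (f - w) (vs k) \<le> t * (c * t * (norm (vs k))\<^sup>2)"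
        using normal[OF vs(2)[of k]] unfolding t_def[symmetric]
        by (simp add: power_mult_distrib power2_eq_square algebra_simps)
      then show ?thesis using \<open>t > 0\<close> unfolding t_def[symmetric] by simp
    qed
    have "(\<lambda>k. inner (f - w) (vs k)) \<longlonglongrightarrow> inner (f - w) v"
      by (intro tendsto_intros vs)
    moreover have "(\<lambda>k. c * (1 / real (Suc k)) * (norm (vs k))\<^sup>2) \<longlonglongrightarrow> c * 0 * (norm v)\<^sup>2"
      by (intro tendsto_intros vs lim_1_over_n[THEN LIMSEQ_Suc])
    ultimately have "inner (f - w) v \<le> c * 0 * (norm v)\<^sup>2"
      by (rule LIMSEQ_le) (use le in auto)
    then show ?thesis by simp
  qed
  \<comment> \<open>\<open>-w\<close> is tangent as well, being the velocity of the time-reversed curve.\<close>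
  have "-w \<in> clarke_tangent_cone \<Omega> (x (- (- r)))"
  proof -
    have "((\<lambda>t. - t) has_vector_derivative - 1) (at (- r))" by (auto intro!: derivative_eq_intros)
    then have "((\<lambda>t. x (- t)) has_vector_derivative - w) (at (- r))"
      using vector_diff_chain_at[of "\<lambda>t. - t" "- 1" "- r" x w] deriv
      by (simp add: o_def)
    moreover have "eventually (\<lambda>t. x (- t) \<in> \<Omega>) (nhds (- r))"
      by (intro eventually_compose_filterlim[OF in\<Omega>]) (auto intro!: tendsto_eq_intros filterlim_ident)
    ultimately show ?thesis
      using prox_regular_derivative_in_tangent_cone[OF assms(1-3), of "\<lambda>t. x (- t)"] by blast
  qed
  from tang[of "-w"] this have "inner (f - w) w \<ge> 0" by simp
  then show "inner (f - w) (v - w) \<le> 0" if "v \<in> clarke_tangent_cone \<Omega> (x r)" for v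
    using tang[OF that] by (simp add: inner_diff_right)
qed

subsection \<open>The catching-up scheme\<close>

lemma telescoping_diff_le:
  fixes b :: "nat \<Rightarrow> real"
  assumes "k \<le> l" "\<And>j. k \<le> j \<Longrightarrow> j < l \<Longrightarrow> b (Suc j) - b j \<le> d"
  shows "b l - b k \<le> (real l - real k) * d"
  using assms
proof (induction l rule: dec_induct)
  case (step l)
  then show ?case by (force simp: algebra_simps)
qed simp

lemma has_vector_derivative_norm_sq_half:
  fixes x :: "real \<Rightarrow> 'a::real_inner"
  assumes "(x has_vector_derivative w) (at r)"
  shows "((\<lambda>t. (norm (x t - y))\<^sup>2 / 2) has_real_derivative inner w (x r - y)) (at r)"
proof -
  have "((\<lambda>t. inner (x t - y) (x t - y) / 2) has_derivative
      (\<lambda>s. (inner (x r - y) (s *\<^sub>R w) + inner (s *\<^sub>R w) (x r - y)) / 2)) (at r)"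
    using assms unfolding has_vector_derivative_def
    by (auto intro!: derivative_eq_intros)
  then show ?thesis
    unfolding has_field_derivative_def power2_norm_eq_inner
    by (rule has_derivative_eq_rhs) (auto simp: inner_commute)
qed

lemma real_derivative_le_slope:
  fixes g :: "real \<Rightarrow> real"
  assumes "(g has_real_derivative D) (at r)" "d > 0"
    and "\<And>t. r < t \<Longrightarrow> t < r + d \<Longrightarrow> g t - g r \<le> c * (t - r)"
  shows "D \<le> c"
proof (rule tendsto_upperbound)
  show "((\<lambda>t. (g t - g r) / (t - r)) \<longlongrightarrow> D) (at_right r)"
    using assms(1) unfolding has_field_derivative_iff
    by (rule filterlim_mono) (auto simp: at_le)
  show "eventually (\<lambda>t. (g t - g r) / (t - r) \<le> c) (at_right r)"
    using assms(2,3) by (intro eventually_at_rightI[of r "r + d"]) (auto simp: divide_le_eq)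
qed simp

text \<open>The velocity is explicit, taken at the old node, while the constraint is imposed at the
  new one. Nearest points need not be unique; \<open>closest_point\<close> selects one, and no
  estimate depends on which.\<close>

primrec catching_up ::
  "'a::euclidean_space set \<Rightarrow> (nat \<Rightarrow> (nat \<Rightarrow> 'a) \<Rightarrow> 'a) \<Rightarrow> real \<Rightarrow> (nat \<Rightarrow> 'a) \<Rightarrow> nat \<Rightarrow> nat \<Rightarrow> 'a" where
  "catching_up \<Omega> F h x0 0 = x0"
| "catching_up \<Omega> F h x0 (Suc k) =
    (\<lambda>i. closest_point \<Omega> (catching_up \<Omega> F h x0 k i + h *\<^sub>R F i (catching_up \<Omega> F h x0 k)))"

locale prox_regular_system =
  fixes \<Omega> :: "'a::euclidean_space set" and \<eta> :: real
    and F :: "nat \<Rightarrow> (nat \<Rightarrow> 'a) \<Rightarrow> 'a" and n :: nat and x0 :: "nat \<Rightarrow> 'a"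
  assumes closed: "closed \<Omega>" and eta_pos: "\<eta> > 0" and prox: "prox_regular \<eta> \<Omega>"
    and init: "\<And>i. i < n \<Longrightarrow> x0 i \<in> \<Omega>"
begin

abbreviation "Y h k \<equiv> catching_up \<Omega> F h x0 k"

lemma catching_up_in: "i < n \<Longrightarrow> Y h k i \<in> \<Omega>"
proof (cases k)
  case (Suc l)
  assume "i < n"
  then have "\<Omega> \<noteq> {}" using init by auto
  with Suc show ?thesis using closest_point_in_set[OF closed] by auto
qed (use init in auto)

lemma catching_up_nearest:
  assumes "i < n"
  shows "Y h (Suc k) i \<in> nearest_points \<Omega> (Y h k i + h *\<^sub>R F i (Y h k))"
proof -
  have "\<Omega> \<noteq> {}" using init assms by auto
  then show ?thesis using closest_point_nearest_points[OF closed] by simp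
qed

text \<open>The old node lies in \<Omega> and so competes with the new one for being
  nearest.\<close>

lemma catching_up_normal_le:
  assumes "i < n" "h \<ge> 0"
  shows "norm (Y h k i + h *\<^sub>R F i (Y h k) - Y h (Suc k) i) \<le> h * norm (F i (Y h k))"
proof -
  have "dist (Y h k i + h *\<^sub>R F i (Y h k)) (Y h (Suc k) i)
      \<le> dist (Y h k i + h *\<^sub>R F i (Y h k)) (Y h k i)"
    using catching_up_nearest[OF assms(1), of h k] catching_up_in[OF assms(1), of h k]
    unfolding nearest_points_def by blast
  then show ?thesis using assms(2) by (simp add: dist_norm)
qed

lemma catching_up_step_le:
  assumes "i < n" "h \<ge> 0"
  shows "norm (Y h (Suc k) i - Y h k i) \<le> 2 * h * norm (F i (Y h k))"
proof -
  have "Y h (Suc k) i - Y h k i =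
      h *\<^sub>R F i (Y h k) - (Y h k i + h *\<^sub>R F i (Y h k) - Y h (Suc k) i)" by simp
  then have "norm (Y h (Suc k) i - Y h k i) \<le>
      norm (h *\<^sub>R F i (Y h k)) + norm (Y h k i + h *\<^sub>R F i (Y h k) - Y h (Suc k) i)"
    by (metis norm_triangle_ineq4)
  moreover have "norm (h *\<^sub>R F i (Y h k)) = h * norm (F i (Y h k))"
    using assms(2) by simp
  ultimately show ?thesis
    using catching_up_normal_le[OF assms, of k] by linarith
qed

text \<open>For old and new nodes a and b, |b - y|^2 - |a - y|^2 = 2<a - b, y - b> - |a - b|^2. The
  last term is dropped and the normal inequality at b bounds the product, so the right-hand side
  carries positions of the new node.\<close>

lemma catching_up_variational_ineq:
  assumes "i < n" "h \<ge> 0" "y \<in> \<Omega>" "norm (F i (Y h k)) \<le> M"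
  shows "((norm (Y h (Suc k) i - y))\<^sup>2 - (norm (Y h k i - y))\<^sup>2) / 2
    \<le> h * (inner (F i (Y h k)) (Y h (Suc k) i - y) + M / (2 * \<eta>) * (norm (Y h (Suc k) i - y))\<^sup>2)"
proof -
  define a where "a = Y h k i"
  define b where "b = Y h (Suc k) i"
  define f where "f = F i (Y h k)"
  have "norm (a + h *\<^sub>R f - b) \<le> h * norm f"
    using catching_up_normal_le[OF assms(1,2)] by (simp only: a_def b_def f_def)
  also have "\<dots> \<le> h * M" using assms by (intro mult_left_mono) (auto simp: f_def)
  finally have le: "norm (a + h *\<^sub>R f - b) \<le> h * M" .
  have "inner (a + h *\<^sub>R f - b) (y - b) \<le> norm (a + h *\<^sub>R f - b) / (2 * \<eta>) * (norm (y - b))\<^sup>2"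
    using prox_regular_nearest_point_inner_le[OF prox eta_pos catching_up_nearest[OF assms(1)] assms(3)]
    by (simp only: a_def b_def f_def)
  also have "\<dots> \<le> h * M / (2 * \<eta>) * (norm (y - b))\<^sup>2"
    using le eta_pos by (intro mult_right_mono divide_right_mono) auto
  finally have 1: "inner (a - b) (y - b) \<le> h * inner f (b - y) + h * M / (2 * \<eta>) * (norm (b - y))\<^sup>2"
    by (simp add: inner_diff_left inner_diff_right inner_add_left norm_minus_commute algebra_simps)
  have "0 \<le> inner (a - b) (a - b)" by simp
  then have "((norm (b - y))\<^sup>2 - (norm (a - y))\<^sup>2) / 2 \<le> inner (a - b) (y - b)"
    unfolding power2_norm_eq_inner
    by (simp add: inner_diff_left inner_diff_right inner_commute)
  with 1 have "((norm (b - y))\<^sup>2 - (norm (a - y))\<^sup>2) / 2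
      \<le> h * inner f (b - y) + h * M / (2 * \<eta>) * (norm (b - y))\<^sup>2" by linarith
  then show ?thesis unfolding a_def[symmetric] b_def[symmetric] f_def[symmetric]
    by (simp add: algebra_simps)
qed

end

section \<open>Limit of the scheme as the step tends to zero\<close>

text \<open>The bound \<open>M T\<close> may depend on the time horizon, since speeds can increase
  with time under linear growth, but not on the step \<open>h\<close>. Continuity is stated along
  filters on pairs of scheme index and time because both vary in the passage to the limit.\<close>

locale bounded_velocity_system = prox_regular_system +
  fixes M :: "real \<Rightarrow> real"
  assumes M_nonneg: "\<And>T. M T \<ge> 0"
    and velocity_le: "\<And>T h k i. 0 < h \<Longrightarrow> h \<le> 1 \<Longrightarrow> real k * h \<le> T \<Longrightarrow> i < n \<Longrightarrow>
      norm (F i (Y h k)) \<le> M T"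
    and F_cont: "\<And>i (H :: (nat \<times> real) filter) z l. i < n \<Longrightarrow>
      (\<And>j. j < n \<Longrightarrow> ((\<lambda>p. z p j) \<longlongrightarrow> l j) H) \<Longrightarrow> ((\<lambda>p. F i (z p)) \<longlongrightarrow> F i l) H"
begin

lemma catching_up_Lipschitz:
  assumes "0 < h" "h \<le> 1" "i < n" "k \<le> l" "real l * h \<le> T"
  shows "norm (Y h l i - Y h k i) \<le> 2 * M T * (h * (real l - real k))"
  using \<open>k \<le> l\<close> \<open>real l * h \<le> T\<close>
proof (induction l rule: dec_induct)
  case (step l)
  have lT: "real l * h \<le> T"
    using step.prems \<open>0 < h\<close> by (simp add: algebra_simps)
  have "norm (Y h (Suc l) i - Y h l i) \<le> 2 * h * norm (F i (Y h l))"
    using assms by (intro catching_up_step_le) auto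
  also have "\<dots> \<le> 2 * h * M T"
    using assms velocity_le[OF assms(1,2) lT \<open>i < n\<close>] by (intro mult_left_mono) auto
  finally have "norm (Y h (Suc l) i - Y h k i) \<le> 2 * h * M T + 2 * M T * (h * (real l - real k))"
    using step.IH[OF lT] norm_triangle_ineq[of "Y h (Suc l) i - Y h l i" "Y h l i - Y h k i"]
    by (simp del: catching_up.simps)
  then show ?case by (simp add: algebra_simps del: catching_up.simps)
qed auto

text \<open>Piecewise constant interpolation takes only node values and thus stays in \<Omega>,
  which affine interpolation would not. Its jumps cause the additional mesh term in
  \<open>X_diff\<close>.\<close>

definition X :: "nat \<Rightarrow> real \<Rightarrow> nat \<Rightarrow> 'a" where
  "X N t = Y (1 / real (Suc N)) (nat \<lfloor>t * real (Suc N)\<rfloor>)"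

lemma step_index:
  assumes "t \<ge> 0"
  shows "real (nat \<lfloor>t * real (Suc N)\<rfloor>) * (1 / real (Suc N)) \<le> t"
    "t - 1 / real (Suc N) < real (nat \<lfloor>t * real (Suc N)\<rfloor>) * (1 / real (Suc N))"
proof -
  have *: "real (nat \<lfloor>t * real (Suc N)\<rfloor>) = of_int \<lfloor>t * real (Suc N)\<rfloor>"
    using assms by (simp add: of_nat_nat)
  have "of_int \<lfloor>t * real (Suc N)\<rfloor> \<le> t * real (Suc N)" by (rule of_int_floor_le)
  then show "real (nat \<lfloor>t * real (Suc N)\<rfloor>) * (1 / real (Suc N)) \<le> t"
    unfolding * by (simp add: field_simps del: of_nat_Suc)
  have "t * real (Suc N) < of_int \<lfloor>t * real (Suc N)\<rfloor> + 1"
    using floor_correct[of "t * real (Suc N)"] by simp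
  then show "t - 1 / real (Suc N) < real (nat \<lfloor>t * real (Suc N)\<rfloor>) * (1 / real (Suc N))"
    unfolding * using less_divide_eq[of t "of_int \<lfloor>t * real (Suc N)\<rfloor> + 1" "real (Suc N)"]
    by (simp add: add_divide_distrib del: of_nat_Suc)
qed

lemma X_diff:
  assumes "i < n" "s \<in> {0..T}" "t \<in> {0..T}"
  shows "norm (X N t i - X N s i) \<le> 2 * M T * (\<bar>t - s\<bar> + 1 / real (Suc N))"
proof -
  have *: "norm (X N t i - X N s i) \<le> 2 * M T * (\<bar>t - s\<bar> + 1 / real (Suc N))"
    if "s \<le> t" "0 \<le> s" "t \<le> T" for s t
  proof -
    define h where "h = 1 / real (Suc N)"
    define k where "k = nat \<lfloor>s * real (Suc N)\<rfloor>"
    define l where "l = nat \<lfloor>t * real (Suc N)\<rfloor>"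
    have h: "0 < h" "h \<le> 1" by (auto simp: h_def)
    have "k \<le> l" unfolding k_def l_def
      using that by (intro nat_mono floor_mono mult_right_mono) auto
    have ind: "real l * h \<le> t" "s - h < real k * h"
      using step_index[of t N] step_index[of s N] that by (auto simp only: h_def k_def l_def)
    have "norm (Y h l i - Y h k i) \<le> 2 * M T * (h * (real l - real k))"
      using h \<open>i < n\<close> \<open>k \<le> l\<close> ind that by (intro catching_up_Lipschitz) auto
    also have "\<dots> \<le> 2 * M T * (t - s + h)"
      using ind M_nonneg[of T] by (intro mult_left_mono) (auto simp: algebra_simps)
    finally show ?thesis
      unfolding X_def h_def[symmetric] k_def[symmetric] l_def[symmetric] using that by simp
  qed
  show ?thesis
    using *[of s t] *[of t s] assms by (cases "s \<le> t") (auto simp: norm_minus_commute abs_minus_commute)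
qed

lemma X_0: "X N 0 = x0"
  by (simp add: X_def)

lemma X_in: "i < n \<Longrightarrow> X N t i \<in> \<Omega>"
  unfolding X_def by (rule catching_up_in)

lemma X_node: "X N (real k * (1 / real (Suc N))) = Y (1 / real (Suc N)) k"
proof -
  have "real k * (1 / real (Suc N)) * real (Suc N) = real k" by (simp del: of_nat_Suc)
  then show ?thesis unfolding X_def by (simp del: of_nat_Suc)
qed

text \<open>A diagonal subsequence converges at all rational times; the Lipschitz bound, valid up to
  the mesh, carries the Cauchy property to the other times.\<close>

lemma subseq_limit:
  obtains \<phi> x where "strict_mono \<phi>" "\<forall>i<n. \<forall>t\<ge>0. (\<lambda>N. X (\<phi> N) t i) \<longlonglongrightarrow> x i t"
proof -
  define D where "D = {..<n} \<times> (\<rat> \<inter> {0::real..})"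
  \<comment> \<open>The extraction theorem asks for one bound valid at all points, so each value is
    divided by its own a priori bound; the summand 1 keeps the divisor positive.\<close>
  define B where "B = (\<lambda>(i, t). norm (x0 i) + 2 * M t * (t + 1) + 1)"
  define f where "f = (\<lambda>N p. X N (snd p) (fst p) /\<^sub>R B p)"
  have B_pos: "B p > 0" if "p \<in> D" for p
  proof -
    obtain i t where p: "p = (i, t)" by (cases p)
    then have "0 \<le> norm (x0 i)" "0 \<le> 2 * M t * (t + 1)"
      using that M_nonneg[of t] by (auto simp: D_def)
    then have "0 < norm (x0 i) + 2 * M t * (t + 1) + 1" by linarith
    then show ?thesis by (simp add: B_def p)
  qed
  have f_le: "norm (f N p) \<le> 1" if "p \<in> D" for N p
  proof -
    obtain i t where p: "p = (i, t)" by (cases p)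
    then have it: "i < n" "t \<ge> 0" using that by (auto simp: D_def)
    have "1 / real (Suc N) \<le> 1" by simp
    have "norm (X N t i - X N 0 i) \<le> 2 * M t * (\<bar>t - 0\<bar> + 1 / real (Suc N))"
      using it by (intro X_diff) auto
    also have "\<dots> \<le> 2 * M t * (t + 1)"
      using it M_nonneg[of t] by (intro mult_left_mono add_mono) auto
    finally have "norm (X N t i) \<le> norm (x0 i) + 2 * M t * (t + 1)"
      using norm_triangle_ineq2[of "X N t i" "x0 i"] by (simp add: X_0)
    then have "norm (X N t i) \<le> B p" by (simp add: B_def p)
    then show ?thesis
      using B_pos[OF that] by (simp add: f_def p field_simps)
  qed
  have "countable D"
    unfolding D_def by (intro countable_SIGMA countable_Int1 countable_rat) auto
  then obtain \<phi> :: "nat \<Rightarrow> nat" where \<phi>: "strict_mono \<phi>"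
      "\<forall>p\<in>D. \<exists>l. (\<lambda>N. f (\<phi> N) p) \<longlonglongrightarrow> l"
    by (rule function_convergent_subsequence[of D f 1, OF _ f_le]) auto
  have rat: "Cauchy (\<lambda>N. X (\<phi> N) q i)" if "i < n" "q \<in> \<rat>" "q \<ge> 0" for i q
  proof -
    have D: "(i, q) \<in> D" using that by (simp add: D_def)
    obtain l where "(\<lambda>N. f (\<phi> N) (i, q)) \<longlonglongrightarrow> l" using \<phi>(2) D by blast
    then have "(\<lambda>N. B (i, q) *\<^sub>R f (\<phi> N) (i, q)) \<longlonglongrightarrow> B (i, q) *\<^sub>R l"
      by (intro tendsto_intros)
    then have "(\<lambda>N. X (\<phi> N) q i) \<longlonglongrightarrow> B (i, q) *\<^sub>R l"
      using B_pos[OF D] by (simp add: f_def)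
    then show ?thesis by (rule LIMSEQ_imp_Cauchy)
  qed
  have "convergent (\<lambda>N. X (\<phi> N) t i)" if "i < n" "t \<ge> 0" for i t
  proof -
    define L where "L = 2 * M (t + 1) + 1"
    have "L > 0" using M_nonneg[of "t + 1"] by (simp add: L_def)
    have "Cauchy (\<lambda>N. X (\<phi> N) t i)"
    proof (rule metric_CauchyI)
      fix e :: real assume "e > 0"
      \<comment> \<open>The time gap and the mesh, each below \<open>d\<close>, cost less than
        \<open>e / 4\<close> together; the minimum with 1 keeps \<open>q\<close> below
        \<open>t + 1\<close>, where \<open>L\<close> applies.\<close>
      define d where "d = min 1 (e / (8 * L))"
      have "d > 0" using \<open>e > 0\<close> \<open>L > 0\<close> by (simp add: d_def)
      obtain q where q: "q \<in> \<rat>" "t < q" "q < t + d"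
        using Rats_dense_in_real[of t "t + d"] \<open>d > 0\<close> by auto
      have "q \<ge> 0" "q \<le> t + 1" using q \<open>t \<ge> 0\<close> by (auto simp: d_def)
      obtain N1 where N1: "\<And>m k. m \<ge> N1 \<Longrightarrow> k \<ge> N1 \<Longrightarrow> dist (X (\<phi> m) q i) (X (\<phi> k) q i) < e / 2"
        using metric_CauchyD[OF rat[OF \<open>i < n\<close> q(1) \<open>q \<ge> 0\<close>], of "e / 2"] \<open>e > 0\<close> by auto
      obtain N2 where N2: "1 / real (Suc N2) < d"
        using \<open>d > 0\<close> nat_approx_posE by blast
      have close: "dist (X (\<phi> m) t i) (X (\<phi> m) q i) < e / 4" if "m \<ge> N2" for m
      proof -
        have "N2 \<le> \<phi> m" using \<phi>(1) that seq_suble[of \<phi> m] by linarith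
        then have "1 / real (Suc (\<phi> m)) \<le> 1 / real (Suc N2)"
          by (intro divide_left_mono) auto
        then have hd: "1 / real (Suc (\<phi> m)) < d" using N2 by linarith
        have "norm (X (\<phi> m) t i - X (\<phi> m) q i) \<le> 2 * M (t + 1) * (\<bar>t - q\<bar> + 1 / real (Suc (\<phi> m)))"
          using \<open>i < n\<close> \<open>t \<ge> 0\<close> \<open>q \<ge> 0\<close> \<open>q \<le> t + 1\<close> by (intro X_diff) auto
        also have "\<dots> \<le> L * (\<bar>t - q\<bar> + 1 / real (Suc (\<phi> m)))"
          by (intro mult_right_mono) (auto simp: L_def)
        also have "\<dots> < L * (d + d)"
          using q hd \<open>L > 0\<close> by (intro mult_strict_left_mono add_strict_mono) auto
        also have "\<dots> \<le> L * (2 * (e / (8 * L)))"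
          using \<open>L > 0\<close> by (intro mult_left_mono) (auto simp: d_def)
        also have "\<dots> = e / 4" using \<open>L > 0\<close> by simp
        finally show ?thesis by (simp add: dist_norm)
      qed
      have "dist (X (\<phi> m) t i) (X (\<phi> k) t i) < e" if "m \<ge> max N1 N2" "k \<ge> max N1 N2" for m k
      proof -
        have "dist (X (\<phi> m) t i) (X (\<phi> k) t i) \<le> dist (X (\<phi> m) t i) (X (\<phi> m) q i)
            + dist (X (\<phi> m) q i) (X (\<phi> k) q i) + dist (X (\<phi> k) t i) (X (\<phi> k) q i)"
          using dist_triangle[of "X (\<phi> m) t i" "X (\<phi> k) t i" "X (\<phi> m) q i"]
            dist_triangle[of "X (\<phi> m) q i" "X (\<phi> k) t i" "X (\<phi> k) q i"]
          by (simp add: dist_commute)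
        then show ?thesis using close[of m] close[of k] N1[of m k] that by simp
      qed
      then show "\<exists>N. \<forall>m\<ge>N. \<forall>k\<ge>N. dist (X (\<phi> m) t i) (X (\<phi> k) t i) < e" by blast
    qed
    then show ?thesis by (simp add: Cauchy_convergent_iff)
  qed
  then have "(\<lambda>N. X (\<phi> N) t i) \<longlonglongrightarrow> lim (\<lambda>N. X (\<phi> N) t i)" if "i < n" "t \<ge> 0" for i t
    using that by (simp add: convergent_LIMSEQ_iff)
  with \<phi>(1) that[of \<phi> "\<lambda>i t. lim (\<lambda>N. X (\<phi> N) t i)"] show thesis by blast
qed

text \<open>For the last claim the limiting right-hand side \<open>c0\<close> is replaced by any
  larger \<open>c\<close>. The discrete right-hand sides are then below \<open>c\<close> for all
  late schemes and all node times near \<open>r\<close>. Summing bounds the increments of |x -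
  y|^2/2 after \<open>r\<close> by c(t - r), hence the derivative <w, x - y> by \<open>c\<close>,
  and \<open>c\<close> may decrease to \<open>c0\<close>.\<close>

lemma
  assumes \<phi>: "strict_mono \<phi>"
    and lim: "\<And>i t. i < n \<Longrightarrow> t \<ge> 0 \<Longrightarrow> (\<lambda>N. X (\<phi> N) t i) \<longlonglongrightarrow> x i t"
  shows limit_Lipschitz: "\<And>i s t T. i < n \<Longrightarrow> s \<in> {0..T} \<Longrightarrow> t \<in> {0..T} \<Longrightarrow>
      norm (x i t - x i s) \<le> 2 * M T * \<bar>t - s\<bar>"
    and limit_in: "\<And>i t. i < n \<Longrightarrow> t \<ge> 0 \<Longrightarrow> x i t \<in> \<Omega>"
    and limit_0: "\<And>i. i < n \<Longrightarrow> x i 0 = x0 i"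
    and limit_variational_ineq: "\<And>i y r w. i < n \<Longrightarrow> y \<in> \<Omega> \<Longrightarrow> r > 0 \<Longrightarrow>
      (x i has_vector_derivative w) (at r) \<Longrightarrow>
      inner (F i (\<lambda>j. x j r) - w) (y - x i r) \<le> M (r + 1) / (2 * \<eta>) * (norm (y - x i r))\<^sup>2"
proof -
  define h where "h N = 1 / real (Suc (\<phi> N))" for N
  have h: "0 < h N" "h N \<le> 1" for N by (auto simp: h_def)
  have h0: "h \<longlonglongrightarrow> 0"
  proof -
    have "((\<lambda>N. 1 / real (Suc N)) \<circ> \<phi>) \<longlonglongrightarrow> 0"
      by (rule LIMSEQ_subseq_LIMSEQ[OF LIMSEQ_Suc[OF lim_1_over_n] \<phi>])
    then show ?thesis by (simp add: h_def[abs_def] o_def del: of_nat_Suc)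
  qed
  show lip: "norm (x i t - x i s) \<le> 2 * M T * \<bar>t - s\<bar>"
    if "i < n" "s \<in> {0..T}" "t \<in> {0..T}" for i s t T
  proof (rule LIMSEQ_le)
    show "(\<lambda>N. norm (X (\<phi> N) t i - X (\<phi> N) s i)) \<longlonglongrightarrow> norm (x i t - x i s)"
      using that by (intro tendsto_intros lim) auto
    have "(\<lambda>N. 2 * M T * (\<bar>t - s\<bar> + h N)) \<longlonglongrightarrow> 2 * M T * (\<bar>t - s\<bar> + 0)"
      by (intro tendsto_intros h0)
    then show "(\<lambda>N. 2 * M T * (\<bar>t - s\<bar> + h N)) \<longlonglongrightarrow> 2 * M T * \<bar>t - s\<bar>" by simp
    show "\<exists>N. \<forall>k\<ge>N. norm (X (\<phi> k) t i - X (\<phi> k) s i) \<le> 2 * M T * (\<bar>t - s\<bar> + h k)"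
      using X_diff[OF that] by (auto simp: h_def)
  qed
  show "x i t \<in> \<Omega>" if "i < n" "t \<ge> 0" for i t
    by (rule closed_sequentially[OF closed X_in[OF \<open>i < n\<close>] lim[OF that]])
  show "x i 0 = x0 i" if "i < n" for i
    using lim[OF that, of 0] by (simp add: X_0 LIMSEQ_const_iff)

  \<comment> \<open>Convergence at fixed times is not enough: the nodes entering the sum move and
    multiply with the scheme. The Lipschitz bounds upgrade it to convergence as index and time vary
    together.\<close>
  have joint: "((\<lambda>p. X (\<phi> (fst p)) (\<sigma> p) i) \<longlongrightarrow> x i r) (sequentially \<times>\<^sub>F nhds r)"
    if "i < n" "r > 0" and \<sigma>: "(\<sigma> \<longlongrightarrow> r) (sequentially \<times>\<^sub>F nhds r)" for i r \<sigma>
  proof (rule Lim_transform)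
    have fst_lim: "filterlim fst sequentially (sequentially \<times>\<^sub>F nhds r)"
      by (rule filterlim_fst)
    show "((\<lambda>p. X (\<phi> (fst p)) r i) \<longlongrightarrow> x i r) (sequentially \<times>\<^sub>F nhds r)"
      using filterlim_compose[OF lim[of i r] fst_lim] that by simp
    have hlim: "((\<lambda>p. h (fst p)) \<longlongrightarrow> 0) (sequentially \<times>\<^sub>F nhds r)"
      using filterlim_compose[OF h0 fst_lim] .
    show "((\<lambda>p. X (\<phi> (fst p)) (\<sigma> p) i - X (\<phi> (fst p)) r i) \<longlongrightarrow> 0) (sequentially \<times>\<^sub>F nhds r)"
    proof (rule Lim_null_comparison)
      have "eventually (\<lambda>p. 0 < \<sigma> p) (sequentially \<times>\<^sub>F nhds r)"
        "eventually (\<lambda>p. \<sigma> p < r + 1) (sequentially \<times>\<^sub>F nhds r)"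
        using \<sigma> \<open>r > 0\<close> by (auto intro: order_tendstoD)
      then show "eventually (\<lambda>p. norm (X (\<phi> (fst p)) (\<sigma> p) i - X (\<phi> (fst p)) r i)
          \<le> 2 * M (r + 1) * (\<bar>\<sigma> p - r\<bar> + h (fst p))) (sequentially \<times>\<^sub>F nhds r)"
        by eventually_elim (use that in \<open>auto intro!: X_diff simp: h_def simp del: of_nat_Suc\<close>)
      have "((\<lambda>p. 2 * M (r + 1) * (\<bar>\<sigma> p - r\<bar> + h (fst p))) \<longlongrightarrow> 2 * M (r + 1) * (\<bar>r - r\<bar> + 0))
          (sequentially \<times>\<^sub>F nhds r)"
        by (intro tendsto_intros \<sigma> hlim)
      then show "((\<lambda>p. 2 * M (r + 1) * (\<bar>\<sigma> p - r\<bar> + h (fst p))) \<longlongrightarrow> 0) (sequentially \<times>\<^sub>F nhds r)"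
        by simp
    qed
  qed

  show "inner (F i (\<lambda>j. x j r) - w) (y - x i r) \<le> M (r + 1) / (2 * \<eta>) * (norm (y - x i r))\<^sup>2"
    if "i < n" "y \<in> \<Omega>" "r > 0" and deriv: "(x i has_vector_derivative w) (at r)" for i y r w
  proof -
    define f where "f = F i (\<lambda>j. x j r)"
    define K where "K = M (r + 1) / (2 * \<eta>)"
    define c0 where "c0 = inner f (x i r - y) + K * (norm (x i r - y))\<^sup>2"
    have "inner w (x i r - y) \<le> c" if "c0 < c" for c
    proof -
      let ?H = "sequentially \<times>\<^sub>F nhds r"
      \<comment> \<open>\<open>G\<close> mirrors the discrete inequality: the velocity at a node,
        the positions one step later. The shift by \<open>h\<close> disappears in the limit.\<close>
      define G where "G p = inner (F i (X (\<phi> (fst p)) (snd p))) (X (\<phi> (fst p)) (snd p + h (fst p)) i - y)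
        + K * (norm (X (\<phi> (fst p)) (snd p + h (fst p)) i - y))\<^sup>2" for p :: "nat \<times> real"
      have fst_lim: "filterlim fst sequentially ?H" and snd_lim: "(snd \<longlongrightarrow> r) ?H"
        by (rule filterlim_fst filterlim_snd)+
      have "((\<lambda>p. snd p + h (fst p)) \<longlongrightarrow> r + 0) ?H"
        by (intro tendsto_intros snd_lim filterlim_compose[OF h0 fst_lim])
      then have succ_lim: "((\<lambda>p. X (\<phi> (fst p)) (snd p + h (fst p)) i) \<longlongrightarrow> x i r) ?H"
        using joint[OF \<open>i < n\<close> \<open>r > 0\<close>] by simp
      have "((\<lambda>p. F i (X (\<phi> (fst p)) (snd p))) \<longlongrightarrow> f) ?H"
        unfolding f_def using \<open>i < n\<close> \<open>r > 0\<close> by (intro F_cont joint snd_lim)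
      then have "(G \<longlongrightarrow> c0) ?H"
        unfolding G_def c0_def by (intro tendsto_intros succ_lim)
      then have "eventually (\<lambda>p. G p < c) ?H"
        using \<open>c0 < c\<close> by (rule order_tendstoD)
      then obtain N0 P where "eventually P (nhds r)"
          and P: "\<And>N t. N \<ge> N0 \<Longrightarrow> P t \<Longrightarrow> G (N, t) < c"
        unfolding eventually_prod_filter eventually_sequentially by metis
      then obtain \<delta> where "\<delta> > 0" and \<delta>: "\<And>t. \<bar>t - r\<bar> < \<delta> \<Longrightarrow> P t"
        unfolding eventually_nhds_metric by (auto simp: dist_real_def)
      \<comment> \<open>\<delta> is the range in which \<open>G\<close> is controlled, and 1 keeps
        all nodes before \<open>r + 1\<close>, where \<open>M (r + 1)\<close> bounds the
        velocity.\<close>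
      define d where "d = min \<delta> (min r 1)"
      have d: "0 < d" "d \<le> \<delta>" "d \<le> r" "d \<le> 1"
        using \<open>\<delta> > 0\<close> \<open>r > 0\<close> by (auto simp: d_def)
      have incr: "(norm (x i t - y))\<^sup>2 / 2 - (norm (x i r - y))\<^sup>2 / 2 \<le> c * (t - r)"
        if t: "r < t" "t < r + d" for t
      proof (rule LIMSEQ_le)
        show "(\<lambda>N. (norm (X (\<phi> N) t i - y))\<^sup>2 / 2 - (norm (X (\<phi> N) r i - y))\<^sup>2 / 2)
            \<longlonglongrightarrow> (norm (x i t - y))\<^sup>2 / 2 - (norm (x i r - y))\<^sup>2 / 2"
          using t \<open>r > 0\<close> \<open>i < n\<close> by (intro tendsto_intros lim) auto
        define k where "k N s = nat \<lfloor>s * real (Suc (\<phi> N))\<rfloor>" for N s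
        have k: "real (k N s) * h N \<le> s" "s - h N < real (k N s) * h N" if "s \<ge> 0" for N s
          using step_index[OF that, of "\<phi> N"] by (auto simp only: h_def k_def)
        have k_lim: "(\<lambda>N. real (k N s) * h N) \<longlonglongrightarrow> s" if "s \<ge> 0" for s
        proof (rule tendsto_sandwich[of "\<lambda>N. s - h N" _ _ "\<lambda>N. s"])
          show "(\<lambda>N. s - h N) \<longlonglongrightarrow> s" using tendsto_diff[OF tendsto_const h0] by simp
        qed (use k(1)[OF that] less_imp_le[OF k(2)[OF that]] in \<open>auto intro!: always_eventually\<close>)
        have "(\<lambda>N. c * (real (k N t) * h N - real (k N r) * h N)) \<longlonglongrightarrow> c * (t - r)"
          using t \<open>r > 0\<close> by (intro tendsto_intros k_lim) auto
        then show "(\<lambda>N. (real (k N t) - real (k N r)) * (h N * c)) \<longlonglongrightarrow> c * (t - r)"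
          by (simp add: algebra_simps)
        \<comment> \<open>The first node of the sum may precede \<open>r\<close>, but by less than
          one step; steps below \<open>d\<close> keep it where \<open>G\<close> is
          controlled.\<close>
        have "eventually (\<lambda>N. h N < d) sequentially"
          using order_tendstoD(2)[OF h0] d by simp
        then have "eventually (\<lambda>N. h N < d \<and> N \<ge> N0) sequentially"
          using eventually_ge_at_top by eventually_elim auto
        then have "eventually (\<lambda>N. (norm (X (\<phi> N) t i - y))\<^sup>2 / 2 - (norm (X (\<phi> N) r i - y))\<^sup>2 / 2
            \<le> (real (k N t) - real (k N r)) * (h N * c)) sequentially"
        proof eventually_elim
          case (elim N)
          have "(norm (Y (h N) (k N t) i - y))\<^sup>2 / 2 - (norm (Y (h N) (k N r) i - y))\<^sup>2 / 2
            \<le> (real (k N t) - real (k N r)) * (h N * c)"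
          proof (rule telescoping_diff_le)
            show "k N r \<le> k N t"
              unfolding k_def using t by (intro nat_mono floor_mono mult_right_mono) auto
            fix j assume j: "k N r \<le> j" "j < k N t"
            have "real j * h N \<le> real (k N t) * h N"
              using j h[of N] by (intro mult_right_mono) auto
            then have jt: "real j * h N \<le> t" using k(1)[of t N] t \<open>r > 0\<close> by linarith
            have "real (k N r) * h N \<le> real j * h N"
              using j h[of N] by (intro mult_right_mono) auto
            then have "r - h N < real j * h N" using k(2)[of r N] \<open>r > 0\<close> by linarith
            then have "\<bar>real j * h N - r\<bar> < \<delta>" using jt t d elim by linarith
            then have "G (N, real j * h N) < c" using elim P \<delta> by blast
            moreover have "X (\<phi> N) (real j * h N) = Y (h N) j"
              unfolding h_def by (rule X_node)
            moreover have "X (\<phi> N) (real j * h N + h N) = Y (h N) (Suc j)"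
              using X_node[of "\<phi> N" "Suc j"] unfolding h_def by (simp add: algebra_simps add_divide_distrib)
            ultimately have "inner (F i (Y (h N) j)) (Y (h N) (Suc j) i - y)
                + K * (norm (Y (h N) (Suc j) i - y))\<^sup>2 < c"
              by (simp add: G_def del: catching_up.simps)
            then have "h N * (inner (F i (Y (h N) j)) (Y (h N) (Suc j) i - y)
                + K * (norm (Y (h N) (Suc j) i - y))\<^sup>2) \<le> h N * c"
              using h[of N] by (intro mult_left_mono) auto
            moreover have "((norm (Y (h N) (Suc j) i - y))\<^sup>2 - (norm (Y (h N) j i - y))\<^sup>2) / 2
                \<le> h N * (inner (F i (Y (h N) j)) (Y (h N) (Suc j) i - y)
                  + K * (norm (Y (h N) (Suc j) i - y))\<^sup>2)"
              unfolding K_def using h[of N] jt t d \<open>i < n\<close> \<open>y \<in> \<Omega>\<close>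
              by (intro catching_up_variational_ineq velocity_le) auto
            ultimately show "(norm (Y (h N) (Suc j) i - y))\<^sup>2 / 2 - (norm (Y (h N) j i - y))\<^sup>2 / 2
                \<le> h N * c"
              unfolding diff_divide_distrib by (rule order_trans[rotated])
          qed
          then show ?case by (simp only: X_def k_def h_def)
        qed
        then show "\<exists>N0. \<forall>N\<ge>N0. (norm (X (\<phi> N) t i - y))\<^sup>2 / 2 - (norm (X (\<phi> N) r i - y))\<^sup>2 / 2
            \<le> (real (k N t) - real (k N r)) * (h N * c)"
          by (simp add: eventually_sequentially)
      qed
      show ?thesis
        by (rule real_derivative_le_slope[OF has_vector_derivative_norm_sq_half[OF deriv] \<open>0 < d\<close> incr])
    qed
    then have "inner w (x i r - y) \<le> c0" by (rule dense_ge)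
    then show ?thesis
      unfolding f_def[symmetric] K_def[symmetric] c0_def
      by (simp add: inner_diff_left inner_diff_right norm_minus_commute algebra_simps)
  qed
qed

lemma projected_system_solution:
  obtains x :: "nat \<Rightarrow> real \<Rightarrow> 'a" where
    "\<And>i s t T. i < n \<Longrightarrow> s \<in> {0..T} \<Longrightarrow> t \<in> {0..T} \<Longrightarrow> norm (x i t - x i s) \<le> 2 * M T * \<bar>t - s\<bar>"
    "\<And>i. i < n \<Longrightarrow> x i 0 = x0 i"
    "\<And>i t. i < n \<Longrightarrow> t \<ge> 0 \<Longrightarrow> x i t \<in> \<Omega>"
    "AE t in lborel. t \<ge> 0 \<longrightarrow> (\<forall>i<n. (x i has_vector_derivative
        tangent_proj \<Omega> (x i t) (F i (\<lambda>j. x j t))) (at t))"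
proof -
  obtain \<phi> x where \<phi>: "strict_mono \<phi>"
      and "\<forall>i<n. \<forall>t\<ge>0. (\<lambda>N. X (\<phi> N) t i) \<longlonglongrightarrow> x i t"
    by (rule subseq_limit)
  then have lim: "\<And>i t. i < n \<Longrightarrow> t \<ge> 0 \<Longrightarrow> (\<lambda>N. X (\<phi> N) t i) \<longlonglongrightarrow> x i t" by blast
  \<comment> \<open>The Lipschitz constant depends on the horizon, so positive times are exhausted
    by bounded intervals. Time 0 is excluded as well, since the limit is controlled only to its
    right.\<close>
  define Z where "Z = (\<Union>i<n. \<Union>k::nat. {t \<in> {0<..<real k}. \<not> x i differentiable (at t)})"
  have "negligible {t \<in> {0<..<real k}. \<not> x i differentiable (at t)}" if "i < n" for i k
    by (rule negligible_not_differentiable_Lipschitz_interval[of 0 "real k" "x i" "2 * M (real k)"])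
      (rule limit_Lipschitz[OF \<phi> lim \<open>i < n\<close>], auto)
  then have "negligible (insert 0 Z)"
    unfolding Z_def by (auto intro!: negligible_Union negligible_countable_Union)
  then have "AE t in lebesgue. t \<notin> insert 0 Z"
    unfolding negligible_iff_null_sets by (rule AE_not_in)
  then have ae: "AE t in lborel. t \<notin> insert 0 Z"
    by (simp add: AE_completion_iff)
  have deriv: "(x i has_vector_derivative tangent_proj \<Omega> (x i t) (F i (\<lambda>j. x j t))) (at t)"
    if "t \<notin> insert 0 Z" "t \<ge> 0" "i < n" for t i
  proof -
    have "t > 0" using that by auto
    obtain k :: nat where "t < real k" using reals_Archimedean2 by blast
    then have "x i differentiable (at t)"
      using that \<open>t > 0\<close> unfolding Z_def by auto
    then obtain w where w: "(x i has_vector_derivative w) (at t)"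
      by (auto simp: vector_derivative_works)
    have "eventually (\<lambda>s. s > 0) (nhds t)"
      using \<open>t > 0\<close> by (intro eventually_nhds_in_open[of "{0<..}", simplified]) auto
    then have "eventually (\<lambda>s. x i s \<in> \<Omega>) (nhds t)"
      by eventually_elim (use limit_in[OF \<phi> lim \<open>i < n\<close>] in auto)
    then have "tangent_proj \<Omega> (x i t) (F i (\<lambda>j. x j t)) = w"
      by (rule tangent_proj_eq_derivative[OF closed eta_pos prox w])
        (rule limit_variational_ineq[OF \<phi> lim \<open>i < n\<close> _ \<open>t > 0\<close> w])
    with w show ?thesis by simp
  qed
  show thesis
  proof
    show "AE t in lborel. t \<ge> 0 \<longrightarrow> (\<forall>i<n. (x i has_vector_derivative
        tangent_proj \<Omega> (x i t) (F i (\<lambda>j. x j t))) (at t))"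
      using ae by eventually_elim (use deriv in auto)
    show "norm (x i t - x i s) \<le> 2 * M T * \<bar>t - s\<bar>"
      if "i < n" "s \<in> {0..T}" "t \<in> {0..T}" for i s t T
      by (rule limit_Lipschitz[OF \<phi> lim that])
    show "x i 0 = x0 i" if "i < n" for i by (rule limit_0[OF \<phi> lim that])
    show "x i t \<in> \<Omega>" if "i < n" "t \<ge> 0" for i t by (rule limit_in[OF \<phi> lim that])
  qed
qed

end

subsection \<open>Systems with interaction and external potentials\<close>

lemma Lipschitz_imp_absolutely_continuous:
  fixes f :: "real \<Rightarrow> 'a::real_normed_vector"
  assumes lip: "\<And>s t. s \<in> {a..b} \<Longrightarrow> t \<in> {a..b} \<Longrightarrow> norm (f t - f s) \<le> L * \<bar>t - s\<bar>" and "L \<ge> 0"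
  shows "absolutely_continuous_on_interval a b f"
  unfolding absolutely_continuous_on_interval_def
proof (intro allI impI)
  fix \<epsilon> :: real assume "\<epsilon> > 0"
  show "\<exists>\<delta>>0. \<forall>(N::nat) l r.
      (\<forall>k<N. a \<le> l k \<and> l k \<le> r k \<and> r k \<le> b) \<and>
      (\<forall>j<N. \<forall>k<N. j \<noteq> k \<longrightarrow> {l j<..<r j} \<inter> {l k<..<r k} = {}) \<and>
      (\<Sum>k<N. r k - l k) < \<delta> \<longrightarrow> (\<Sum>k<N. norm (f (r k) - f (l k))) < \<epsilon>"
  \<comment> \<open>Dividing by \<open>L + 1\<close> covers the case that \<open>L\<close> is
    0.\<close>
  proof (intro exI[of _ "\<epsilon> / (L + 1)"] conjI allI impI; (elim conjE)?)
    show "0 < \<epsilon> / (L + 1)" using \<open>\<epsilon> > 0\<close> \<open>L \<ge> 0\<close> by simp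
    fix N :: nat and l r :: "nat \<Rightarrow> real"
    assume lr: "\<forall>k<N. a \<le> l k \<and> l k \<le> r k \<and> r k \<le> b"
      and less: "(\<Sum>k<N. r k - l k) < \<epsilon> / (L + 1)"
    have nonneg: "0 \<le> (\<Sum>k<N. r k - l k)" using lr by (intro sum_nonneg) auto
    have "(\<Sum>k<N. norm (f (r k) - f (l k))) \<le> (\<Sum>k<N. L * (r k - l k))"
    proof (rule sum_mono)
      fix k assume "k \<in> {..<N}"
      then show "norm (f (r k) - f (l k)) \<le> L * (r k - l k)"
        using lip[of "l k" "r k"] lr by force
    qed
    also have "\<dots> = L * (\<Sum>k<N. r k - l k)" by (rule sum_distrib_left[symmetric])
    also have "\<dots> \<le> (L + 1) * (\<Sum>k<N. r k - l k)"
      using nonneg by (intro mult_right_mono) auto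
    also have "\<dots> < (L + 1) * (\<epsilon> / (L + 1))"
      using less \<open>L \<ge> 0\<close> by (intro mult_strict_left_mono) auto
    also have "\<dots> = \<epsilon>" using \<open>L \<ge> 0\<close> by simp
    finally show "(\<Sum>k<N. norm (f (r k) - f (l k))) < \<epsilon>" .
  qed
qed

lemma continuous_bounded_on_cball:
  fixes g :: "'a::euclidean_space \<Rightarrow> 'b::real_normed_vector"
  assumes "continuous_on UNIV g"
  obtains B where "B \<ge> 0" "\<And>x. norm x \<le> R \<Longrightarrow> norm (g x) \<le> B"
proof -
  have "compact (g ` cball 0 R)"
    using assms continuous_on_subset by (intro compact_continuous_image) auto
  then obtain B where B: "\<forall>x\<in>g ` cball 0 R. norm x \<le> B"
    using compact_imp_bounded bounded_iff by blast
  show thesis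
    by (rule that[of "max 0 B"]) (use B in \<open>auto simp: le_max_iff_disj\<close>)
qed

section \<open>Velocity bounds for interaction and external forces\<close>

definition interaction_velocity ::
  "('a::real_normed_vector \<Rightarrow> 'a) \<Rightarrow> ('a \<Rightarrow> 'a) \<Rightarrow> (nat \<Rightarrow> real) \<Rightarrow> nat \<Rightarrow> nat \<Rightarrow> (nat \<Rightarrow> 'a) \<Rightarrow> 'a" where
  "interaction_velocity gW gV m n i z = - (\<Sum>j<n. m j *\<^sub>R gW (z i - z j)) - gV (z i)"

text \<open>The weights form a convex combination, so the interaction part inherits the bound of a
  single summand.\<close>

lemma norm_interaction_velocity_le:
  assumes "\<forall>j<n. m j \<ge> 0" "(\<Sum>j<n. m j) = 1"
    and "\<And>j. j < n \<Longrightarrow> norm (gW (z i - z j)) \<le> a" "norm (gV (z i)) \<le> b"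
  shows "norm (interaction_velocity gW gV m n i z) \<le> a + b"
proof -
  have "norm (\<Sum>j<n. m j *\<^sub>R gW (z i - z j)) \<le> (\<Sum>j<n. norm (m j *\<^sub>R gW (z i - z j)))"
    by (rule norm_sum)
  also have "\<dots> \<le> (\<Sum>j<n. m j * a)"
    using assms by (intro sum_mono) (auto intro!: mult_left_mono)
  also have "\<dots> = a" using assms(2) by (simp add: sum_distrib_right[symmetric])
  finally show ?thesis
    using assms(4) norm_triangle_ineq4[of "- (\<Sum>j<n. m j *\<^sub>R gW (z i - z j))" "gV (z i)"]
    unfolding interaction_velocity_def by simp
qed

lemma tendsto_interaction_velocity:
  assumes "continuous_on UNIV gW" "continuous_on UNIV gV" "i < n"
    and z: "\<And>j. j < n \<Longrightarrow> ((\<lambda>p. z p j) \<longlongrightarrow> l j) H"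
  shows "((\<lambda>p. interaction_velocity gW gV m n i (z p)) \<longlongrightarrow> interaction_velocity gW gV m n i l) H"
proof -
  have c: "isCont gW x" "isCont gV x" for x
    using assms(1,2) by (auto simp: continuous_on_eq_continuous_at)
  show ?thesis
    unfolding interaction_velocity_def
    using assms(3) by (intro tendsto_intros isCont_tendsto_compose[OF c(1)] isCont_tendsto_compose[OF c(2)] z) auto
qed

text \<open>All nodes stay in \<Omega>, hence in a ball of radius R, and their differences in one of
  radius 2R; the continuous gradients are bounded there.\<close>

lemma (in prox_regular_system) bounded_domain_velocity_bound:
  assumes "bounded \<Omega>" "continuous_on UNIV gW" "continuous_on UNIV gV"
    and m: "\<forall>j<n. m j \<ge> 0" "(\<Sum>j<n. m j) = 1"
    and F: "F = interaction_velocity gW gV m n"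
  shows "\<exists>B\<ge>0. \<forall>h k i. i < n \<longrightarrow> norm (F i (Y h k)) \<le> B"
proof -
  obtain R where R: "\<And>x. x \<in> \<Omega> \<Longrightarrow> norm x \<le> R"
    using \<open>bounded \<Omega>\<close> by (auto simp: bounded_iff)
  obtain a where a: "a \<ge> 0" "\<And>x. norm x \<le> 2 * R \<Longrightarrow> norm (gW x) \<le> a"
    using continuous_bounded_on_cball[OF assms(2)] by blast
  obtain b where b: "b \<ge> 0" "\<And>x. norm x \<le> R \<Longrightarrow> norm (gV x) \<le> b"
    using continuous_bounded_on_cball[OF assms(3)] by blast
  have "norm (interaction_velocity gW gV m n i (Y h k)) \<le> a + b" if "i < n" for h k i
  proof (rule norm_interaction_velocity_le[OF m])
    have Y: "norm (Y h k j) \<le> R" if "j < n" for j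
      using that by (intro R catching_up_in)
    show "norm (gW (Y h k i - Y h k j)) \<le> a" if "j < n" for j
      using Y[OF \<open>i < n\<close>] Y[OF that] norm_triangle_ineq4[of "Y h k i" "Y h k j"] by (intro a(2)) linarith
    show "norm (gV (Y h k i)) \<le> b"
      by (intro b(2) Y that)
  qed
  then have "norm (F i (Y h k)) \<le> a + b" if "i < n" for h k i
    using that by (simp add: F)
  then show ?thesis using a b by (intro exI[of _ "a + b"]) auto
qed

text \<open>If 1 + |x_j| \<le> \<rho> for every particle, then 1 + |x_i - x_j| \<le> 2\<rho>, so
  interaction contributes 2C\<rho> and the external force C\<rho>. A step has length at most 2h
  times the velocity, which gives the growth factor 1 + 6Ch \<le> exp(6Ch); after k steps only the
  elapsed time kh matters.\<close>

lemma (in prox_regular_system) linear_growth_velocity_bound: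
  assumes growth: "\<And>x. norm (gW x) \<le> C * (1 + norm x)" "\<And>x. norm (gV x) \<le> C * (1 + norm x)"
    and m: "\<forall>j<n. m j \<ge> 0" "(\<Sum>j<n. m j) = 1"
    and F: "F = interaction_velocity gW gV m n"
  shows "\<exists>B\<ge>0. \<forall>h k i. 0 < h \<longrightarrow> real k * h \<le> T \<longrightarrow> i < n \<longrightarrow> norm (F i (Y h k)) \<le> B"
proof -
  have "0 \<le> norm (gW 0)" by simp
  also have "\<dots> \<le> C" using growth(1)[of 0] by simp
  finally have "C \<ge> 0" .
  define R where "R = 1 + (\<Sum>i<n. norm (x0 i))"
  have R_pos: "R > 0" unfolding R_def by (smt (verit) norm_ge_zero sum_nonneg)
  have R: "1 + norm (x0 i) \<le> R" if "i < n" for i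
    using member_le_sum[of i "{..<n}" "\<lambda>i. norm (x0 i)"] that by (simp add: R_def)
  have vel: "norm (F i z) \<le> 3 * C * \<rho>"
    if "\<And>j. j < n \<Longrightarrow> 1 + norm (z j) \<le> \<rho>" "i < n" for z \<rho> i
  proof -
    have "norm (F i z) \<le> C * (2 * \<rho>) + C * \<rho>"
      unfolding F
    proof (rule norm_interaction_velocity_le[OF m])
      fix j assume "j < n"
      have "1 + norm (z i - z j) \<le> 2 * \<rho>"
        using that(1)[OF \<open>i < n\<close>] that(1)[OF \<open>j < n\<close>] norm_triangle_ineq4[of "z i" "z j"] by linarith
      then show "norm (gW (z i - z j)) \<le> C * (2 * \<rho>)"
        using growth(1)[of "z i - z j"] \<open>C \<ge> 0\<close> by (meson mult_left_mono order_trans)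
    next
      show "norm (gV (z i)) \<le> C * \<rho>"
        using growth(2)[of "z i"] that(1)[OF \<open>i < n\<close>] \<open>C \<ge> 0\<close> by (meson mult_left_mono order_trans)
    qed
    then show ?thesis by simp
  qed
  \<comment> \<open>The induction treats all particles at once, because each velocity involves every
    position; \<open>R\<close> therefore dominates all initial positions together.\<close>
  have Y_le: "1 + norm (Y h k i) \<le> R * (1 + 6 * C * h) ^ k" if "h > 0" "i < n" for h k i
    using \<open>i < n\<close>
  proof (induction k arbitrary: i)
    case (Suc k)
    define \<rho> where "\<rho> = R * (1 + 6 * C * h) ^ k"
    have "norm (F i (Y h k)) \<le> 3 * C * \<rho>"
      using Suc by (intro vel) (auto simp: \<rho>_def)
    then have "2 * h * norm (F i (Y h k)) \<le> 2 * h * (3 * C * \<rho>)"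
      using \<open>h > 0\<close> by (intro mult_left_mono) auto
    moreover have "norm (Y h (Suc k) i) \<le> norm (Y h k i) + norm (Y h (Suc k) i - Y h k i)"
      by (rule norm_triangle_sub)
    moreover have "norm (Y h (Suc k) i - Y h k i) \<le> 2 * h * norm (F i (Y h k))"
      using Suc.prems \<open>h > 0\<close> by (intro catching_up_step_le) auto
    ultimately have "1 + norm (Y h (Suc k) i) \<le> \<rho> + 2 * h * (3 * C * \<rho>)"
      using Suc.IH[OF Suc.prems] unfolding \<rho>_def[symmetric] by linarith
    also have "\<dots> = R * (1 + 6 * C * h) ^ Suc k" by (simp add: \<rho>_def algebra_simps)
    finally show ?case .
  qed (use R in auto)
  have "norm (F i (Y h k)) \<le> 3 * C * (R * exp (6 * C * T))"
    if "0 < h" "real k * h \<le> T" "i < n" for h k i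
  proof (rule vel[OF _ \<open>i < n\<close>])
    fix j assume "j < n"
    have "(1 + 6 * C * h) ^ k \<le> exp (6 * C * h) ^ k"
      using \<open>C \<ge> 0\<close> \<open>h > 0\<close> by (intro power_mono exp_ge_add_one_self) auto
    also have "\<dots> = exp (6 * C * (real k * h))"
      by (simp add: exp_of_nat_mult[symmetric] algebra_simps)
    also have "\<dots> \<le> exp (6 * C * T)"
      using \<open>C \<ge> 0\<close> that(2) by (simp add: mult_left_mono)
    finally have "R * (1 + 6 * C * h) ^ k \<le> R * exp (6 * C * T)"
      using R_pos by (intro mult_left_mono) auto
    then show "1 + norm (Y h k j) \<le> R * exp (6 * C * T)"
      using Y_le[OF \<open>0 < h\<close> \<open>j < n\<close>, of k] by linarith
  qed
  then show ?thesis
    using \<open>C \<ge> 0\<close> R_pos by (intro exI[of _ "3 * C * (R * exp (6 * C * T))"]) auto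
qed

theorem theorem2p6:
  fixes \<Omega> :: "'a::euclidean_space set"
    and \<eta> :: real
    and W V :: "'a \<Rightarrow> real"
    and gW gV :: "'a \<Rightarrow> 'a"
    and lamW lamV C :: real
    and n :: nat
    and x0 :: "nat \<Rightarrow> 'a"
    and m :: "nat \<Rightarrow> real"
  assumes closed: "closed \<Omega>"
    and eta_pos: "\<eta> > 0"
    and prox: "prox_regular \<eta> \<Omega>"
    and W_C1: "C1_with_gradient W gW"
    and V_C1: "C1_with_gradient V gV"
    and cases:
      "(bounded \<Omega> \<and> geodesically_convex_on lamW (convex hull (set_diff_minus \<Omega>)) W gW
                  \<and> geodesically_convex_on lamV (convex hull \<Omega>) V gV)
       \<or> (\<not> bounded \<Omega> \<and> (\<forall>x. norm (gW x) \<le> C * (1 + norm x))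
                      \<and> (\<forall>x. norm (gV x) \<le> C * (1 + norm x)))"
    and init: "\<forall>i<n. x0 i \<in> \<Omega>"
    and m_nonneg: "\<forall>i<n. m i \<ge> 0"
    and m_sum: "(\<Sum>i<n. m i) = 1"
  shows "\<exists>x :: nat \<Rightarrow> real \<Rightarrow> 'a.
           (\<forall>i<n. locally_absolutely_continuous_nonneg (x i)) \<and>
           (\<forall>i<n. x i 0 = x0 i) \<and>
           (\<forall>i<n. \<forall>t\<ge>0. x i t \<in> \<Omega>) \<and>
           (AE t in lborel. t \<ge> 0 \<longrightarrow>
              (\<forall>i<n. (x i has_vector_derivative
                  tangent_proj \<Omega> (x i t)
                    (- (\<Sum>j<n. m j *\<^sub>R gW (x i t - x j t)) - gV (x i t))) (at t)))"
proof -
  define F where "F = interaction_velocity gW gV m n"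
  interpret prox_regular_system \<Omega> \<eta> F n x0
    by unfold_locales (use closed eta_pos prox init in auto)
  have cont: "continuous_on UNIV gW" "continuous_on UNIV gV"
    using W_C1 V_C1 by (auto simp: C1_with_gradient_def)
  \<comment> \<open>Both alternatives end in a velocity bound that is uniform in the step for each
    horizon; choosing one for every \<open>T\<close> produces the function \<open>M\<close>.\<close>
  have "\<exists>B\<ge>0. \<forall>h k i. 0 < h \<longrightarrow> real k * h \<le> T \<longrightarrow> i < n \<longrightarrow> norm (F i (Y h k)) \<le> B" for T
    using cases
  proof (elim disjE conjE)
    assume "bounded \<Omega>"
    from bounded_domain_velocity_bound[OF this cont m_nonneg m_sum F_def] show ?thesis by blast
  next
    assume "\<forall>x. norm (gW x) \<le> C * (1 + norm x)" "\<forall>x. norm (gV x) \<le> C * (1 + norm x)"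
    then show ?thesis
      by (intro linear_growth_velocity_bound[OF _ _ m_nonneg m_sum F_def]) auto
  qed
  then obtain M where M: "\<And>T. M T \<ge> 0"
      "\<And>T h k i. 0 < h \<Longrightarrow> real k * h \<le> T \<Longrightarrow> i < n \<Longrightarrow> norm (F i (Y h k)) \<le> M T"
    by metis
  interpret bounded_velocity_system \<Omega> \<eta> F n x0 M
  proof unfold_locales
    fix i and H :: "(nat \<times> real) filter" and z :: "nat \<times> real \<Rightarrow> nat \<Rightarrow> 'a" and l
    assume "i < n" "\<And>j. j < n \<Longrightarrow> ((\<lambda>p. z p j) \<longlongrightarrow> l j) H"
    then show "((\<lambda>p. F i (z p)) \<longlongrightarrow> F i l) H"
      unfolding F_def by (rule tendsto_interaction_velocity[OF cont])
  qed (use M in auto)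
  obtain x where
    lip: "\<And>i s t T. i < n \<Longrightarrow> s \<in> {0..T} \<Longrightarrow> t \<in> {0..T} \<Longrightarrow> norm (x i t - x i s) \<le> 2 * M T * \<bar>t - s\<bar>"
    and x: "\<And>i. i < n \<Longrightarrow> x i 0 = x0 i" "\<And>i t. i < n \<Longrightarrow> t \<ge> 0 \<Longrightarrow> x i t \<in> \<Omega>"
      "AE t in lborel. t \<ge> 0 \<longrightarrow> (\<forall>i<n. (x i has_vector_derivative
        tangent_proj \<Omega> (x i t) (F i (\<lambda>j. x j t))) (at t))"
    by (rule projected_system_solution) blast
  have "locally_absolutely_continuous_nonneg (x i)" if "i < n" for i
    unfolding locally_absolutely_continuous_nonneg_def
  proof (intro allI impI)
    fix T :: real
    show "absolutely_continuous_on_interval 0 T (x i)"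
      using Lipschitz_imp_absolutely_continuous[of 0 T "x i" "2 * M T"] lip[OF that] M(1) by simp
  qed
  with x show ?thesis
    unfolding F_def interaction_velocity_def by blast
qed

end
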